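(* Let $T$ be the symmetric tridiagonal operator determined by sequences $a_n>0$, $b_n\in\mathbb{R}$ ($n\ge 1$). Suppose $\lim_{n\to\infty}|b_n|=\infty$ and that at least one of the following conditions holds: $$(\mathfrak{B}_1)\quad \lim_{n\to\infty}\frac{a_na_{n-1}}{|b_n|}=0;$$ $$(\mathfrak{B}_2)\quad \lim_{n\to\infty}\frac{a_na_{n-1}(a_{n-1}+a_{n-2})}{|b_n|\,|b_{n-1}|}=0;$$ $$(\mathfrak{B}_3)\quad \lim_{n\to\infty}\frac{a_na_{n-1}}{|b_n|\,|b_{n-1}|}\left[\frac{a_{n-1}^2}{|b_n|}+\frac{a_{n-2}(a_{n-2}+a_{n-3})}{|b_{n-2}|}\right]=0;$$ $$(\mathfrak{B}_4)\quad \lim_{n\to\infty}\frac{a_na_{n-1}}{|b_n|\,|b_{n-1}|}\left[\left(\frac{a_{n-1}^2}{|b_n|}+\frac{a_{n-2}^2}{|b_{n-2}|}\right)\frac{a_{n-1}+a_{n-2}}{|b_{n-1}|}+\frac{a_{n-2}a_{n-3}(a_{n-3}+a_{n-4})}{|b_{n-2}|\,|b_{n-3}|}\right]=0.$$ Then $T$ is self-adjoint and $\Lambda(T)=\sigma(T)$.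
   Context: $(H,(\cdot,\cdot))$ is an infinite-dimensional complex Hilbert space with orthonormal basis $\{e_n\}_{n=1}^\infty$. Given real sequences $a_n>0$, $b_n\in\mathbb{R}$ ($n\ge1$), the formula $Te_n=a_ne_{n+1}+b_ne_n+a_{n-1}e_{n-1}$ (with $e_0=0$) defines a symmetric operator on the linear span of $\{e_n\}_{n=1}^\infty$; $T$ denotes the closure of this operator. $\sigma(T)$ is the spectrum of $T$. $T_N=P_NTP_N$ regarded as an operator on $H_N=\operatorname{span}\{e_1,\dots,e_N\}$, where $P_N$ is the orthogonal projection onto $H_N$. $\Lambda(T)$ is the set of all limit points of eigenvalues of $T_N$ as $N\to\infty$: $\lambda\in\Lambda(T)$ iff there is a sequence $\lambda_N\in\sigma(T_N)$ ($N\ge1$) having a subsequence converging to $\lambda$. The expressions in the limits are considered for $n$ large enough that all the indices are positive and all the denominators are nonzero. *)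

theory Defs
  imports "HOL-Analysis.Analysis"
begin

text \<open>
  Complex Hilbert spaces. The underlying norm and topology are those of the class
  \<open>banach\<close>; the axioms below tie them to the complex scalar multiplication and
  the inner product, which is linear in the first argument.
\<close>

class complex_hilbert_space = banach +
  fixes scaleC :: "complex \<Rightarrow> 'a \<Rightarrow> 'a" (infixr "*\<^sub>C" 75)
    and cinner :: "'a \<Rightarrow> 'a \<Rightarrow> complex"
  assumes scaleC_add_right: "c *\<^sub>C (x + y) = c *\<^sub>C x + c *\<^sub>C y"
    and scaleC_add_left: "(c + d) *\<^sub>C x = c *\<^sub>C x + d *\<^sub>C x"
    and scaleC_scaleC: "c *\<^sub>C d *\<^sub>C x = (c * d) *\<^sub>C x"
    and scaleC_of_real: "complex_of_real r *\<^sub>C x = r *\<^sub>R x"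
    and cinner_add_left: "cinner (x + y) z = cinner x z + cinner y z"
    and cinner_scaleC_left: "cinner (c *\<^sub>C x) y = c * cinner x y"
    and cinner_commute: "cinner y x = cnj (cinner x y)"
    and cinner_self: "cinner x x = complex_of_real ((norm x)\<^sup>2)"

global_interpretation complex_vector:
  vector_space "scaleC :: complex \<Rightarrow> 'a \<Rightarrow> 'a::complex_hilbert_space"
  defines cspan = complex_vector.span
proof
  fix x :: 'a
  show "1 *\<^sub>C x = x"
    using scaleC_of_real[of 1 x] by simp
qed (simp_all add: scaleC_add_right scaleC_add_left scaleC_scaleC)

text \<open>The vectors are numbered from 1; the value \<open>e 0\<close> is ignored.\<close>

definition orthonormal_basis :: "(nat \<Rightarrow> 'a::complex_hilbert_space) \<Rightarrow> bool" where
  "orthonormal_basis e \<longleftrightarrow>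
     (\<forall>m\<ge>1. \<forall>n\<ge>1. cinner (e m) (e n) = (if m = n then 1 else 0)) \<and>
     closure (cspan (e ` {1..})) = UNIV"

text \<open>
  A (possibly unbounded) operator is represented by its graph. Thus its domain is
  \<open>Domain T\<close>, and the closure of a closable operator is the topological closure
  of its graph in the product space.
\<close>

definition adjoint_op ::
    "('a::complex_hilbert_space \<times> 'a) set \<Rightarrow> ('a \<times> 'a) set" where
  "adjoint_op T = {(y, z). \<forall>(x, w)\<in>T. cinner w y = cinner x z}"

definition self_adjoint_op :: "('a::complex_hilbert_space \<times> 'a) set \<Rightarrow> bool" where
  "self_adjoint_op T \<longleftrightarrow>
     single_valued T \<and> closure (Domain T) = UNIV \<and> adjoint_op T = T"

text \<open>
  Resolvent set and spectrum of an operator \<open>T\<close> acting in a closed subspace \<open>K\<close>: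
  \<open>\<mu>\<close> is in the resolvent set iff \<open>T - \<mu>\<close> maps the domain of \<open>T\<close> bijectively
  onto \<open>K\<close> and the inverse is bounded.
\<close>

definition resolvent_set_in ::
    "'a::complex_hilbert_space set \<Rightarrow> ('a \<times> 'a) set \<Rightarrow> complex set" where
  "resolvent_set_in K T =
     {\<mu>. bij_betw (\<lambda>(x, y). y - \<mu> *\<^sub>C x) T K \<and>
         (\<exists>C. \<forall>(x, y)\<in>T. norm x \<le> C * norm (y - \<mu> *\<^sub>C x))}"

definition spectrum_in ::
    "'a::complex_hilbert_space set \<Rightarrow> ('a \<times> 'a) set \<Rightarrow> complex set" where
  "spectrum_in K T = - resolvent_set_in K T"

abbreviation spectrum_op :: "('a::complex_hilbert_space \<times> 'a) set \<Rightarrow> complex set" where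
  "spectrum_op T \<equiv> spectrum_in UNIV T"

definition orth_proj :: "'a::complex_hilbert_space set \<Rightarrow> 'a \<Rightarrow> 'a" where
  "orth_proj K x = (THE y. y \<in> K \<and> (\<forall>z\<in>K. cinner (x - y) z = 0))"

text \<open>
  The operator \<open>P T P\<close> on \<open>K\<close>, where \<open>P\<close> is the orthogonal projection onto \<open>K\<close>.
\<close>

definition compression ::
    "'a::complex_hilbert_space set \<Rightarrow> ('a \<times> 'a) set \<Rightarrow> ('a \<times> 'a) set" where
  "compression K T = {(x, orth_proj K y) | x y. x \<in> K \<and> (orth_proj K x, y) \<in> T}"

text \<open>
  The case distinction implements the convention that the vector preceding \<open>e 1\<close>
  is zero, so that neither \<open>a 0\<close>, \<open>b 0\<close> nor \<open>e 0\<close> matters.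
\<close>

definition tridiagonal_image ::
    "(nat \<Rightarrow> 'a::complex_hilbert_space) \<Rightarrow> (nat \<Rightarrow> real) \<Rightarrow> (nat \<Rightarrow> real) \<Rightarrow> nat \<Rightarrow> 'a" where
  "tridiagonal_image e a b n =
     a n *\<^sub>R e (n + 1) + b n *\<^sub>R e n + (if n = 1 then 0 else a (n - 1) *\<^sub>R e (n - 1))"

text \<open>The graph of the linear extension of this formula to the linear span of the basis.\<close>

definition tridiagonal_pre ::
    "(nat \<Rightarrow> 'a::complex_hilbert_space) \<Rightarrow> (nat \<Rightarrow> real) \<Rightarrow> (nat \<Rightarrow> real) \<Rightarrow> ('a \<times> 'a) set" where
  "tridiagonal_pre e a b =
     {(\<Sum>n=1..k. c n *\<^sub>C e n, \<Sum>n=1..k. c n *\<^sub>C tridiagonal_image e a b n) | k c. True}"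

definition tridiagonal_op ::
    "(nat \<Rightarrow> 'a::complex_hilbert_space) \<Rightarrow> (nat \<Rightarrow> real) \<Rightarrow> (nat \<Rightarrow> real) \<Rightarrow> ('a \<times> 'a) set" where
  "tridiagonal_op e a b = closure (tridiagonal_pre e a b)"

definition truncation_spectrum ::
    "(nat \<Rightarrow> 'a::complex_hilbert_space) \<Rightarrow> ('a \<times> 'a) set \<Rightarrow> nat \<Rightarrow> complex set" where
  "truncation_spectrum e T N =
     spectrum_in (cspan (e ` {1..N})) (compression (cspan (e ` {1..N})) T)"

definition limit_points ::
    "(nat \<Rightarrow> 'a::complex_hilbert_space) \<Rightarrow> ('a \<times> 'a) set \<Rightarrow> complex set" where
  "limit_points e T =
     {\<mu>. \<exists>l. (\<forall>N\<ge>1. l N \<in> truncation_spectrum e T N) \<and>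
            (\<exists>r. strict_mono r \<and> (l \<circ> r) \<longlonglongrightarrow> \<mu>)}"

end

theory Submission
  imports Defs
begin

text \<open>
  Let \<open>(T\<^sub>N - z) x\<close> have no components in the last four coordinates of \<open>H\<^sub>N\<close>, and write \<open>u\<^sub>n\<close> for
  the coordinates of \<open>x\<close>. Regarded as a vector of \<open>H\<close>, \<open>x\<close> satisfies
  \<open>(T - z) x = (T\<^sub>N - z) x + a\<^sub>N u\<^sub>N e\<^sub>N\<^sub>+\<^sub>1\<close>. Solving the last rows of the recurrence for
  \<open>u\<^sub>N, u\<^sub>N\<^sub>-\<^sub>1, \<dots>\<close> and substituting repeatedly bounds the boundary term \<open>a\<^sub>N u\<^sub>N\<close> by a constant
  multiple of the norm of \<open>x\<close> times the expression in any of the four conditions, so it vanishes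
  in the limit.

  Applied to normalised eigenvectors of \<open>T\<^sub>N\<close>, this produces approximate eigenvectors of \<open>T\<close>, whence
  every limit point of eigenvalues is in the spectrum. Conversely, if \<open>T\<^sub>N - z\<close> is bounded below by
  some \<open>\<delta> > 0\<close> for infinitely many \<open>N\<close>, then so is \<open>T - z\<close>, and the solutions of \<open>(T\<^sub>N - z) x = f\<close>
  show that its range is dense, hence everything. For nonreal \<open>z\<close> this gives self-adjointness; for
  real \<open>z\<close> the optimal \<open>\<delta>\<close> is the distance from \<open>z\<close> to the nearest eigenvalue of \<open>T\<^sub>N\<close>, so a
  point of the spectrum is a limit of eigenvalues.
\<close>

section \<open>Complex Hilbert spaces and unbounded operators\<close>

lemma cinner_add_right: "cinner x (y + z) = cinner x y + cinner x z"
  for x y z :: "'a::complex_hilbert_space"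
  by (metis cinner_add_left cinner_commute complex_cnj_add)

lemma cinner_scaleC_right: "cinner x (c *\<^sub>C y) = cnj c * cinner x y"
  for x y :: "'a::complex_hilbert_space"
  by (metis cinner_commute cinner_scaleC_left complex_cnj_mult)

lemma cinner_scaleR_left: "cinner (r *\<^sub>R x) y = r *\<^sub>R cinner x y"
  for x y :: "'a::complex_hilbert_space"
  by (metis cinner_scaleC_left scaleC_of_real scaleR_conv_of_real)

lemma cinner_scaleR_right: "cinner x (r *\<^sub>R y) = r *\<^sub>R cinner x y"
  for x y :: "'a::complex_hilbert_space"
  by (metis cinner_scaleC_right complex_cnj_complex_of_real scaleC_of_real scaleR_conv_of_real)

lemma norm_add_power2:
  "(norm (x + y))\<^sup>2 = (norm x)\<^sup>2 + (norm y)\<^sup>2 + 2 * Re (cinner x y)"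
  for x y :: "'a::complex_hilbert_space"
proof -
  have "complex_of_real ((norm (x + y))\<^sup>2)
      = complex_of_real ((norm x)\<^sup>2) + complex_of_real ((norm y)\<^sup>2)
        + (cinner x y + cnj (cinner x y))"
    unfolding cinner_self[symmetric] cinner_commute[of y x, symmetric]
    by (simp add: cinner_add_left cinner_add_right)
  then show ?thesis
    unfolding complex_add_cnj
    by (metis of_real_add of_real_eq_iff)
qed

lemma norm_scaleC: "norm (c *\<^sub>C x) = cmod c * norm x"
  for x :: "'a::complex_hilbert_space"
proof -
  have "complex_of_real ((norm (c *\<^sub>C x))\<^sup>2) = cinner (c *\<^sub>C x) (c *\<^sub>C x)"
    by (simp only: cinner_self)
  also have "\<dots> = c * cnj c * complex_of_real ((norm x)\<^sup>2)"
    by (simp only: cinner_self[of x] cinner_scaleC_left cinner_scaleC_right mult_ac)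
  also have "\<dots> = complex_of_real ((cmod c * norm x)\<^sup>2)"
    by (simp add: complex_norm_square[symmetric] power_mult_distrib)
  finally have "(norm (c *\<^sub>C x))\<^sup>2 = (cmod c * norm x)\<^sup>2"
    using of_real_eq_iff by blast
  then show ?thesis
    by (simp add: power2_eq_iff_nonneg)
qed

text \<open>The Cauchy-Schwarz inequality, read off from the nonnegative squared norm of
  \<open>r *\<^sub>R x + (- c) *\<^sub>C y\<close>, the component of \<open>x\<close> orthogonal to
  \<open>y\<close> multiplied by \<open>r\<close> to avoid a division.\<close>

lemma norm_cinner_le: "cmod (cinner x y) \<le> norm x * norm y"
  for x y :: "'a::complex_hilbert_space"
proof (cases "norm y = 0")
  case True
  then have "y = 0 *\<^sub>C y" by simp
  then have "cinner x y = 0" by (metis cinner_scaleC_right complex_cnj_zero mult_zero_left)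
  then show ?thesis by simp
next
  case False
  define r where "r = (norm y)\<^sup>2"
  define c where "c = cinner x y"
  have r: "r > 0" using False by (simp add: r_def)
  have "0 \<le> (norm (r *\<^sub>R x + (- c) *\<^sub>C y))\<^sup>2" by simp
  also have "\<dots> = r\<^sup>2 * (norm x)\<^sup>2 + (cmod c)\<^sup>2 * r + 2 * Re (r *\<^sub>R (cnj (- c) * c))"
    unfolding norm_add_power2 norm_scaleC norm_scaleR cinner_scaleR_left cinner_scaleC_right
    by (simp add: power_mult_distrib r_def c_def)
  also have "Re (r *\<^sub>R (cnj (- c) * c)) = - (r * (cmod c)\<^sup>2)"
    unfolding cmod_power2 by (simp add: power2_eq_square)
  also have "r\<^sup>2 * (norm x)\<^sup>2 + (cmod c)\<^sup>2 * r + 2 * - (r * (cmod c)\<^sup>2)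
      = r * ((norm x * norm y)\<^sup>2 - (cmod c)\<^sup>2)"
    by (simp add: r_def power2_eq_square algebra_simps)
  finally have "(cmod c)\<^sup>2 \<le> (norm x * norm y)\<^sup>2"
    using r by (simp add: zero_le_mult_iff)
  then show ?thesis
    unfolding c_def by (rule power2_le_imp_le) simp
qed

interpretation cinner: bounded_bilinear "cinner :: 'a::complex_hilbert_space \<Rightarrow> _"
  by (standard; (intro exI[of _ 1])?)
     (simp_all add: cinner_add_left cinner_add_right cinner_scaleR_left cinner_scaleR_right
       norm_cinner_le)

interpretation scaleC: bounded_bilinear "scaleC :: _ \<Rightarrow> 'a::complex_hilbert_space \<Rightarrow> _"
proof (standard, goal_cases)
  case (3 r c x)
  show ?case by (metis scaleC_of_real scaleC_scaleC scaleR_conv_of_real)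
next
  case (4 c r x)
  show ?case by (metis mult.commute scaleC_of_real scaleC_scaleC)
next
  case 5
  show ?case by (intro exI[of _ 1]) (simp add: norm_scaleC)
qed (simp_all add: scaleC_add_left scaleC_add_right)

lemma cinner_eq_zero_iff: "cinner x x = 0 \<longleftrightarrow> x = 0" for x :: "'a::complex_hilbert_space"
  by (simp add: cinner_self)

text \<open>Orthogonality to \<open>x\<close> is a closed condition, so it reaches \<open>x\<close>
  itself.\<close>

lemma eq_zero_if_cinner_dense:
  fixes x :: "'a::complex_hilbert_space"
  assumes "closure S = UNIV" "\<And>y. y \<in> S \<Longrightarrow> cinner x y = 0"
  shows "x = 0"
proof -
  have "closed {y. cinner x y = 0}"
    by (intro closed_Collect_eq continuous_intros cinner.continuous_on)
  then have "closure S \<subseteq> {y. cinner x y = 0}"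
    using assms by (intro closure_minimal) auto
  then show ?thesis
    using assms(1) cinner_eq_zero_iff by auto
qed

lemma subspace_closure:
  fixes S :: "'a::real_normed_vector set"
  assumes "subspace S"
  shows "subspace (closure S)"
  unfolding subspace_def
proof (intro conjI ballI allI)
  show "0 \<in> closure S"
    using closure_subset subspace_0[OF assms] by blast
  fix x c assume "x \<in> closure S"
  then obtain f where f: "\<And>n. f n \<in> S" "f \<longlonglongrightarrow> x"
    by (auto simp: closure_sequential)
  have "(\<lambda>n. c *\<^sub>R f n) \<longlonglongrightarrow> c *\<^sub>R x"
    by (intro tendsto_intros f)
  then show "c *\<^sub>R x \<in> closure S"
    unfolding closure_sequential using subspace_scale[OF assms f(1)]
    by (intro exI[of _ "\<lambda>n. c *\<^sub>R f n"]) simp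
  fix y assume "y \<in> closure S"
  then obtain g where g: "\<And>n. g n \<in> S" "g \<longlonglongrightarrow> y"
    by (auto simp: closure_sequential)
  have "(\<lambda>n. f n + g n) \<longlonglongrightarrow> x + y"
    by (intro tendsto_intros f g)
  then show "x + y \<in> closure S"
    unfolding closure_sequential using subspace_add[OF assms f(1) g(1)]
    by (intro exI[of _ "\<lambda>n. f n + g n"]) simp
qed

section \<open>Adjoints and a criterion for self-adjointness\<close>

lemma closed_adjoint: "closed (adjoint_op S)"
proof -
  have "adjoint_op S = (\<Inter>(x, w)\<in>S. {p. cinner w (fst p) = cinner x (snd p)})"
    by (auto simp: adjoint_op_def)
  also have "closed \<dots>"
    by (auto intro!: closed_INT closed_Collect_eq cinner.continuous_on continuous_intros)
  finally show ?thesis .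
qed

text \<open>The pairing that defines the adjoint is continuous on the graph and so survives limits.
  This reduces symmetry of a closed operator to a check on a core.\<close>

lemma adjoint_closure: "adjoint_op (closure S) = adjoint_op S"
proof
  show "adjoint_op (closure S) \<subseteq> adjoint_op S"
    using closure_subset by (force simp: adjoint_op_def)
  show "adjoint_op S \<subseteq> adjoint_op (closure S)"
  proof
    fix p assume p: "p \<in> adjoint_op S"
    obtain y z where yz: "p = (y, z)" by (cases p)
    have "closed {q. cinner (snd q) y = cinner (fst q) z}"
      by (intro closed_Collect_eq cinner.continuous_on continuous_intros)
    moreover have "S \<subseteq> {q. cinner (snd q) y = cinner (fst q) z}"
      using p by (auto simp: adjoint_op_def yz)
    ultimately have "closure S \<subseteq> {q. cinner (snd q) y = cinner (fst q) z}"
      by (rule closure_minimal[rotated])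
    then show "p \<in> adjoint_op (closure S)"
      by (auto simp: adjoint_op_def yz)
  qed
qed

lemma single_valued_adjoint:
  assumes "closure (Domain S) = UNIV"
  shows "single_valued (adjoint_op S)"
proof (rule single_valuedI)
  fix y z z' assume *: "(y, z) \<in> adjoint_op S" "(y, z') \<in> adjoint_op S"
  have "z - z' = 0"
  proof (rule eq_zero_if_cinner_dense[OF assms])
    fix x assume "x \<in> Domain S"
    then have "cinner x z = cinner x z'"
      using * by (fastforce simp: adjoint_op_def)
    then show "cinner (z - z') x = 0"
      using cinner_commute[of x z] cinner_commute[of x z'] by (simp add: cinner.diff_left)
  qed
  then show "z = z'" by simp
qed

lemma adjoint_op_diff:
  "(x, y) \<in> adjoint_op S \<Longrightarrow> (x', y') \<in> adjoint_op S \<Longrightarrow> (x - x', y - y') \<in> adjoint_op S"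
  by (auto simp: adjoint_op_def cinner.diff_right split_beta)

lemma resolvent_set_surj:
  assumes "z \<in> resolvent_set_in K T" "f \<in> K"
  obtains x y where "(x, y) \<in> T" "y - z *\<^sub>C x = f"
proof -
  have "f \<in> (\<lambda>(x, y). y - z *\<^sub>C x) ` T"
    using assms by (simp add: resolvent_set_in_def bij_betw_def)
  then show ?thesis using that by auto
qed

text \<open>For \<open>(y, z)\<close> in the adjoint, surjectivity of \<open>T - \<i>\<close> gives
  \<open>(x, w)\<close> in \<open>T\<close> with the same image. The difference
  \<open>d = y - x\<close> is then sent to \<open>\<i> *\<^sub>C d\<close> by the adjoint, so it is
  orthogonal to the range of \<open>T + \<i>\<close>, which is everything.\<close>

lemma self_adjointI:
  assumes sym: "T \<subseteq> adjoint_op T" and dense: "closure (Domain T) = UNIV"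
    and res: "\<i> \<in> resolvent_set_in UNIV T" "- \<i> \<in> resolvent_set_in UNIV T"
  shows "self_adjoint_op T"
proof -
  have "adjoint_op T \<subseteq> T"
  proof safe
    fix y z assume yz: "(y, z) \<in> adjoint_op T"
    obtain x w where xw: "(x, w) \<in> T" "w - \<i> *\<^sub>C x = z - \<i> *\<^sub>C y"
      using resolvent_set_surj[OF res(1) UNIV_I] .
    define d where "d = y - x"
    have zw: "z - w = \<i> *\<^sub>C d"
      using xw(2) by (simp add: d_def scaleC.diff_right algebra_simps)
    have "(d, \<i> *\<^sub>C d) \<in> adjoint_op T"
      using adjoint_op_diff[OF yz, of x w] xw(1) sym unfolding d_def[symmetric] zw by auto
    moreover obtain p q where pq: "(p, q) \<in> T" "q - (- \<i>) *\<^sub>C p = d"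
      using resolvent_set_surj[OF res(2) UNIV_I] .
    ultimately have "cinner q d = cinner p (\<i> *\<^sub>C d)"
      by (auto simp: adjoint_op_def)
    then have "cinner (q - (- \<i>) *\<^sub>C p) d = 0"
      by (simp add: cinner_add_left cinner_scaleC_left cinner_scaleC_right)
    then have "d = 0" unfolding pq(2) cinner_eq_zero_iff .
    then have "y = x" "z = w" using zw by (simp_all add: d_def)
    then show "(y, z) \<in> T" using xw by simp
  qed
  moreover have "single_valued T"
    using single_valued_adjoint[OF dense] sym by (rule single_valued_subset[rotated])
  ultimately show ?thesis
    using sym dense by (auto simp: self_adjoint_op_def)
qed

lemma orth_proj_eqI:
  assumes K: "complex_vector.subspace K" and y: "y \<in> K" "\<And>z. z \<in> K \<Longrightarrow> cinner (x - y) z = 0"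
  shows "orth_proj K x = y"
  unfolding orth_proj_def
proof (rule the_equality)
  fix y' assume y': "y' \<in> K \<and> (\<forall>z\<in>K. cinner (x - y') z = 0)"
  have "y' - y \<in> K" using K y y' by (simp add: complex_vector.subspace_diff)
  then have "cinner ((x - y) - (x - y')) (y' - y) = 0"
    using y y' unfolding cinner.diff_left by simp
  then show "y' = y" by (simp add: cinner_eq_zero_iff)
qed (use y in blast)

section \<open>Hermitian operators on a subspace with compact unit sphere\<close>

locale hermitian_on =
  fixes K :: "'a::complex_hilbert_space set" and A :: "'a \<Rightarrow> 'a"
  assumes subspace: "complex_vector.subspace K"
    and add: "A (x + y) = A x + A y"
    and scale: "A (c *\<^sub>C x) = c *\<^sub>C A x"
    and maps: "x \<in> K \<Longrightarrow> A x \<in> K"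
    and hermitian: "x \<in> K \<Longrightarrow> y \<in> K \<Longrightarrow> cinner (A x) y = cinner x (A y)"
begin

lemma diff: "A (x - y) = A x - A y"
  using add[of "x - y" y] by (simp add: algebra_simps)

text \<open>A real shift preserves symmetry; this moves a statement about the eigenvalue nearest 0
  to any real point.\<close>

lemma shift: "hermitian_on K (\<lambda>x. A x - complex_of_real r *\<^sub>C x)"
  using subspace maps hermitian
  by unfold_locales
    (auto simp: add scale algebra_simps scaleC.diff_right scaleC_add_right scaleC_scaleC
      mult.commute cinner.diff_left cinner.diff_right cinner_scaleC_left cinner_scaleC_right
      intro: complex_vector.subspace_diff complex_vector.subspace_scale)

text \<open>Since \<open>cinner (A x) x\<close> is real, the imaginary part of
  \<open>cinner (A x - z *\<^sub>C x) x\<close> comes from \<open>z\<close> alone, and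
  Cauchy-Schwarz applies.\<close>

lemma Im_bound:
  assumes "x \<in> K"
  shows "\<bar>Im z\<bar> * norm x \<le> norm (A x - z *\<^sub>C x)"
proof (cases "x = 0")
  case False
  have "cinner (A x) x = cnj (cinner (A x) x)"
    using hermitian[OF assms assms] by (simp flip: cinner_commute)
  then have "Im (cinner (A x) x) = 0"
    by (metis Reals_cnj_iff complex_is_Real_iff)
  then have "\<bar>Im z\<bar> * (norm x)\<^sup>2 = \<bar>Im (cinner (A x - z *\<^sub>C x) x)\<bar>"
    by (simp add: cinner.diff_left cinner_scaleC_left cinner_self abs_mult flip: of_real_power)
  also have "\<dots> \<le> norm (A x - z *\<^sub>C x) * norm x"
    using abs_Im_le_cmod norm_cinner_le order_trans by blast
  finally show ?thesis
    using False by (simp add: power2_eq_square)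
qed auto

text \<open>By compactness \<open>norm (A x)\<close> attains a minimum \<open>d\<close> on the unit
  sphere. The minimiser satisfies \<open>A (A x) = d\<^sup>2 x\<close>, and factoring this equation
  yields an eigenvector for \<open>d\<close> or \<open>- d\<close>.\<close>

lemma min_modulus_eigenvalue:
  assumes cont: "continuous_on UNIV A" and compact: "compact (K \<inter> sphere 0 1)" and "K \<noteq> {0}"
  obtains \<nu> x where "x \<in> K" "x \<noteq> 0" "A x = complex_of_real \<nu> *\<^sub>C x"
    "\<And>y. y \<in> K \<Longrightarrow> \<bar>\<nu>\<bar> * norm y \<le> norm (A y)"
proof -
  have normalise: "complex_of_real (inverse (norm y)) *\<^sub>C y \<in> K \<inter> sphere 0 1" if "y \<in> K" "y \<noteq> 0" for y
    using that subspace by (simp add: complex_vector.subspace_scale norm_scaleC norm_inverse)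
  obtain y where "y \<in> K" "y \<noteq> 0"
    using \<open>K \<noteq> {0}\<close> complex_vector.subspace_0[OF subspace] by blast
  then have "K \<inter> sphere 0 1 \<noteq> {}" using normalise by blast
  moreover have "continuous_on (K \<inter> sphere 0 1) (\<lambda>x. norm (A x))"
    by (intro continuous_on_norm continuous_on_subset[OF cont]) auto
  ultimately obtain x where x: "x \<in> K" "norm x = 1"
    and min: "\<And>y. y \<in> K \<inter> sphere 0 1 \<Longrightarrow> norm (A x) \<le> norm (A y)"
    using continuous_attains_inf[OF compact, of "\<lambda>x. norm (A x)"] by force
  define d where "d = norm (A x)"
  have bound: "d * norm y \<le> norm (A y)" if "y \<in> K" for y
  proof (cases "y = 0")
    case False
    then show ?thesis
      using min[OF normalise[OF that False]]
      by (simp add: scale norm_scaleC norm_inverse norm_divide d_def divide_simps)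
  qed auto
  define w where "w = A (A x) - complex_of_real (d\<^sup>2) *\<^sub>C x"
  have w: "w \<in> K"
    unfolding w_def using x maps subspace
    by (intro complex_vector.subspace_diff complex_vector.subspace_scale) auto
  define g where "g = (norm (A w))\<^sup>2 - d\<^sup>2 * (norm w)\<^sup>2"
  \<comment> \<open>the first variation of \<open>norm (A y)\<^sup>2 - d\<^sup>2 * norm y\<^sup>2\<close> at its minimum \<open>x\<close> in the direction \<open>w\<close>\<close>
  have variation: "2 * t * (norm w)\<^sup>2 \<le> t\<^sup>2 * g" for t :: real
  proof -
    have [simp]: "(\<bar>t\<bar>)\<^sup>2 = t\<^sup>2" by simp
    let ?y = "x + (- complex_of_real t) *\<^sub>C w"
    have "?y \<in> K"
      using x w subspace by (intro complex_vector.subspace_add complex_vector.subspace_scale) auto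
    then have min_y: "d\<^sup>2 * (norm ?y)\<^sup>2 \<le> (norm (A ?y))\<^sup>2"
      using bound[of ?y] power_mono[of "d * norm ?y" "norm (A ?y)" 2]
      by (simp add: power_mult_distrib d_def)
    have ny: "(norm ?y)\<^sup>2 = 1 + t\<^sup>2 * (norm w)\<^sup>2 - 2 * t * Re (cinner x w)"
      unfolding norm_add_power2 norm_scaleC cinner_scaleC_right using x
      by (simp add: power_mult_distrib)
    have nAy: "(norm (A ?y))\<^sup>2 = d\<^sup>2 + t\<^sup>2 * (norm (A w))\<^sup>2 - 2 * t * Re (cinner (A x) (A w))"
      unfolding add scale norm_add_power2 norm_scaleC cinner_scaleC_right
      by (simp add: power_mult_distrib d_def)
    \<comment> \<open>Moving \<open>A\<close> across the inner product makes the linear coefficient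
      of the variation exactly \<open>(norm w)\<^sup>2\<close>; the direction \<open>w\<close> is
      chosen for this.\<close>
    have re: "Re (cinner (A x) (A w)) - d\<^sup>2 * Re (cinner x w) = (norm w)\<^sup>2"
    proof -
      have "cinner (A x) (A w) - complex_of_real (d\<^sup>2) * cinner x w = cinner w w"
        using hermitian[of "A x" w] w x maps
        by (subst (3) w_def) (simp add: cinner.diff_left cinner_scaleC_left)
      then show ?thesis
        by (simp add: complex_eq_iff cinner_self del: of_real_power)
    qed
    have "2 * t * (norm w)\<^sup>2 = 2 * t * Re (cinner (A x) (A w)) - d\<^sup>2 * (2 * t * Re (cinner x w))"
      unfolding re[symmetric] by (simp add: algebra_simps)
    moreover have "t\<^sup>2 * g = t\<^sup>2 * (norm (A w))\<^sup>2 - d\<^sup>2 * (t\<^sup>2 * (norm w)\<^sup>2)"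
      by (simp add: g_def algebra_simps)
    ultimately show ?thesis
      using min_y[unfolded ny nAy] unfolding right_diff_distrib distrib_left by linarith
  qed
  have "w = 0"
  proof (rule ccontr)
    assume "w \<noteq> 0"
    then have s: "(norm w)\<^sup>2 > 0" by simp
    \<comment> \<open>Small enough that the second-order part \<open>t * g\<close> is at most
      \<open>(norm w)\<^sup>2\<close>, half of what the variation forces; the 1 keeps the
      denominator positive.\<close>
    define t where "t = (norm w)\<^sup>2 / (\<bar>g\<bar> + 1)"
    have t: "t > 0" using s by (simp add: t_def add_nonneg_pos)
    have "t * (2 * (norm w)\<^sup>2) \<le> t * (t * g)"
      using variation[of t] by (simp add: power2_eq_square[of t] mult_ac)
    then have "2 * (norm w)\<^sup>2 \<le> t * g"
      using t mult_le_cancel_left_pos by blast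
    also have "\<dots> \<le> t * (\<bar>g\<bar> + 1)" using t by (intro mult_left_mono) auto
    also have "\<dots> = (norm w)\<^sup>2" by (simp add: t_def)
    finally show False using s by simp
  qed
  then have AA: "A (A x) = complex_of_real (d\<^sup>2) *\<^sub>C x" by (simp add: w_def)
  have "d \<ge> 0" by (simp add: d_def)
  \<comment> \<open>From \<open>(A - d) (A + d) x = 0\<close>: either \<open>v = (A + d) x\<close>
    vanishes and \<open>x\<close> belongs to \<open>- d\<close>, or \<open>v\<close> is an
    eigenvector for \<open>d\<close>.\<close>
  define v where "v = A x + complex_of_real d *\<^sub>C x"
  show ?thesis
  proof (cases "v = 0")
    case True
    then have "A x = complex_of_real (- d) *\<^sub>C x"
      by (simp add: v_def eq_neg_iff_add_eq_0)
    moreover have "x \<noteq> 0" using x by auto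
    ultimately show ?thesis
      using bound \<open>d \<ge> 0\<close> by (intro that[of x "- d"] x(1)) simp_all
  next
    case False
    have "A v = complex_of_real d *\<^sub>C v"
      unfolding v_def add scale AA
      by (simp add: scaleC_add_right scaleC_scaleC power2_eq_square add.commute)
    moreover have "v \<in> K"
      unfolding v_def using x maps subspace
      by (intro complex_vector.subspace_add complex_vector.subspace_scale) auto
    ultimately show ?thesis
      using bound \<open>d \<ge> 0\<close> by (intro that[of v d] False) simp_all
  qed
qed

text \<open>An eigenvalue of minimal modulus of the shifted operator is an eigenvalue of
  \<open>A\<close> nearest to \<open>r\<close>. This replaces diagonalisation of the
  truncations.\<close>

lemma nearest_eigenvalue:
  assumes "continuous_on UNIV A" "compact (K \<inter> sphere 0 1)" "K \<noteq> {0}"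
  obtains \<mu> x where "x \<in> K" "x \<noteq> 0" "A x = complex_of_real \<mu> *\<^sub>C x"
    "\<And>y. y \<in> K \<Longrightarrow> \<bar>\<mu> - r\<bar> * norm y \<le> norm (A y - complex_of_real r *\<^sub>C y)"
proof -
  interpret B: hermitian_on K "\<lambda>x. A x - complex_of_real r *\<^sub>C x"
    by (rule shift)
  have "continuous_on UNIV (\<lambda>x. A x - complex_of_real r *\<^sub>C x)"
    by (intro continuous_intros assms scaleC.continuous_on)
  then obtain \<nu> x where *: "x \<in> K" "x \<noteq> 0"
    "A x - complex_of_real r *\<^sub>C x = complex_of_real \<nu> *\<^sub>C x"
    "\<And>y. y \<in> K \<Longrightarrow> \<bar>\<nu>\<bar> * norm y \<le> norm (A y - complex_of_real r *\<^sub>C y)"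
    by (rule B.min_modulus_eigenvalue[OF _ assms(2,3)]) (rule that)
  have "A x = complex_of_real (\<nu> + r) *\<^sub>C x"
    using *(3) by (simp add: algebra_simps scaleC_add_left)
  then show ?thesis
    using * by (intro that[of x "\<nu> + r"]) simp_all
qed

end

section \<open>Decay of the boundary term\<close>

text \<open>The diagonal coefficient \<open>b - z\<close> has modulus at least half that of
  \<open>b\<close>, so a row of the recurrence can be solved for its middle entry.\<close>

lemma recurrence_bound:
  fixes u :: "nat \<Rightarrow> complex"
  assumes "a (Suc n) * u (n + 2) + b (Suc n) * u (Suc n) + a n * u n = z * u (Suc n)"
    and "0 \<le> a (Suc n)" "0 \<le> a n" "cmod z \<le> \<bar>b (Suc n)\<bar> / 2" "b (Suc n) \<noteq> 0"
  shows "cmod (u (Suc n))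
    \<le> 2 * (a (Suc n) * cmod (u (n + 2)) + a n * cmod (u n)) / \<bar>b (Suc n)\<bar>"
proof -
  have "\<bar>b (Suc n)\<bar> / 2 * cmod (u (Suc n)) \<le> cmod (b (Suc n) - z) * cmod (u (Suc n))"
    using norm_triangle_ineq2[of "complex_of_real (b (Suc n))" z] assms(4)
    by (intro mult_right_mono) auto
  also have "\<dots> = cmod (a (Suc n) * u (n + 2) + a n * u n)"
  proof -
    have "(b (Suc n) - z) * u (Suc n) = - (a (Suc n) * u (n + 2) + a n * u n)"
      using assms(1) by (auto simp: algebra_simps eq_neg_iff_add_eq_0)
    then show ?thesis by (metis norm_minus_cancel norm_mult)
  qed
  also have "\<dots> \<le> a (Suc n) * cmod (u (n + 2)) + a n * cmod (u n)"
    using assms(2,3) by (intro norm_triangle_le) (simp add: norm_mult)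
  finally show ?thesis
    using assms(5) by (simp add: field_simps)
qed

text \<open>
  Here \<open>v0, v1, \<dots>\<close> are the moduli of the entries \<open>u N, u (N - 1), \<dots>\<close> of a solution of the
  truncated recurrence, and likewise for \<open>a\<close> and \<open>b\<close>. The four bounds come from substituting
  the recurrence into \<open>a0 * v0\<close> one, two, three and four times.
\<close>

lemma boundary_bounds:
  fixes v0 v1 v2 v3 v4 C a0 a1 a2 a3 a4 b0 b1 b2 b3 :: real
  assumes v: "0 \<le> v0" "0 \<le> v1" "0 \<le> v2" "0 \<le> v3" "0 \<le> v4"
    and C: "v0 \<le> C" "v1 \<le> C" "v2 \<le> C" "v3 \<le> C" "v4 \<le> C"
    and a: "0 \<le> a0" "0 \<le> a1" "0 \<le> a2" "0 \<le> a3" "0 \<le> a4"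
    and b: "0 < b0" "0 < b1" "0 < b2" "0 < b3"
    and r0: "v0 \<le> 2 * (a1 * v1) / b0"
    and r1: "v1 \<le> 2 * (a1 * v0 + a2 * v2) / b1"
    and r2: "v2 \<le> 2 * (a2 * v1 + a3 * v3) / b2"
    and r3: "v3 \<le> 2 * (a3 * v2 + a4 * v4) / b3"
  shows "a0 * v0 \<le> 16 * C * (a0 * a1 / b0)"
    and "a0 * v0 \<le> 16 * C * (a0 * a1 * (a1 + a2) / (b0 * b1))"
    and "a0 * v0 \<le> 16 * C * (a0 * a1 / (b0 * b1) * (a1\<^sup>2 / b0 + a2 * (a2 + a3) / b2))"
    and "a0 * v0 \<le> 16 * C * (a0 * a1 / (b0 * b1) *
      ((a1\<^sup>2 / b0 + a2\<^sup>2 / b2) * ((a1 + a2) / b1) + a2 * a3 * (a3 + a4) / (b2 * b3)))"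
proof -
  note nn = mult_nonneg_nonneg divide_nonneg_pos add_nonneg_nonneg mult_pos_pos
  have C0: "0 \<le> C" using v C by linarith
  define p where "p = a0 * a1 / b0"
  have p: "0 \<le> p" unfolding p_def using a b by (intro nn) auto
  define q where "q = p / b1"
  have q: "0 \<le> q" unfolding q_def using p b by (intro nn) auto
  have q': "q = a0 * a1 / (b0 * b1)" by (simp add: q_def p_def)
  have s1: "a0 * v0 \<le> 2 * p * v1"
  proof -
    have "a0 * v0 \<le> a0 * (2 * (a1 * v1) / b0)" using r0 a by (intro mult_left_mono) auto
    then show ?thesis by (simp add: p_def algebra_simps)
  qed
  have s2: "a0 * v0 \<le> 4 * q * (a1 * v0 + a2 * v2)"
  proof -
    have "2 * p * v1 \<le> 2 * p * (2 * (a1 * v0 + a2 * v2) / b1)"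
      using r1 p by (intro mult_left_mono) auto
    then show ?thesis using s1 by (simp add: q_def algebra_simps)
  qed
  \<comment> \<open>Third substitution: the terms \<open>a1 * v0\<close> and \<open>a2 * v2\<close>
    left by the first two are re-expressed through \<open>v1\<close> and \<open>v3\<close>.\<close>
  have w0: "a1 * v0 \<le> 2 * (a1\<^sup>2 / b0 * v1)"
  proof -
    have "a1 * v0 \<le> a1 * (2 * (a1 * v1) / b0)" using r0 a by (intro mult_left_mono) auto
    then show ?thesis by (simp add: power2_eq_square algebra_simps)
  qed
  have w2: "a2 * v2 \<le> 2 * (a2\<^sup>2 / b2 * v1 + a2 * a3 / b2 * v3)"
  proof -
    have "a2 * v2 \<le> a2 * (2 * (a2 * v1 + a3 * v3) / b2)" using r2 a by (intro mult_left_mono) auto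
    also have "\<dots> = 2 * (a2\<^sup>2 / b2 * v1 + a2 * a3 / b2 * v3)"
      by (simp add: power2_eq_square add_divide_distrib algebra_simps)
    finally show ?thesis .
  qed
  define x where "x = a1\<^sup>2 / b0 + a2\<^sup>2 / b2"
  define y where "y = a2 * a3 / b2"
  have x: "0 \<le> x" and y: "0 \<le> y" unfolding x_def y_def using a b by (auto intro!: nn)
  have s3: "a0 * v0 \<le> 8 * q * (x * v1 + y * v3)"
  proof -
    have "a1 * v0 + a2 * v2 \<le> 2 * (x * v1 + y * v3)"
      using w0 w2 by (simp add: x_def y_def algebra_simps)
    then have "4 * q * (a1 * v0 + a2 * v2) \<le> 4 * q * (2 * (x * v1 + y * v3))"
      using q by (intro mult_left_mono) auto
    with s2 show ?thesis by linarith
  qed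
  \<comment> \<open>Fourth substitution: the neighbours of \<open>v1\<close> and \<open>v3\<close>
    are now simply bounded by \<open>C\<close>.\<close>
  have v1: "v1 \<le> 2 * ((a1 + a2) / b1 * C)"
  proof -
    have "2 * (a1 * v0 + a2 * v2) / b1 \<le> 2 * (a1 * C + a2 * C) / b1"
      using a b C by (intro divide_right_mono mult_left_mono add_mono) auto
    then show ?thesis using r1 by (simp add: algebra_simps)
  qed
  have v3: "v3 \<le> 2 * ((a3 + a4) / b3 * C)"
  proof -
    have "2 * (a3 * v2 + a4 * v4) / b3 \<le> 2 * (a3 * C + a4 * C) / b3"
      using a b C by (intro divide_right_mono mult_left_mono add_mono) auto
    then show ?thesis using r3 by (simp add: algebra_simps)
  qed
  \<comment> \<open>The successive substitutions produce the factors 2, 4, 8 and 16; all are relaxed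
    to 16 so that the four cases can be treated alike.\<close>
  have weaken: "k * (C * t) \<le> 16 * C * t" if "0 \<le> t" "k \<le> 16" for k t :: real
    using that C0 mult_right_mono[of k 16 "C * t"] by simp
  have "2 * p * v1 \<le> 2 * p * C" using p C by (intro mult_left_mono) auto
  then show "a0 * v0 \<le> 16 * C * (a0 * a1 / b0)"
    using s1 weaken[OF p, of 2] by (simp add: p_def algebra_simps)
  have "a1 * v0 + a2 * v2 \<le> a1 * C + a2 * C"
    using a C by (intro add_mono mult_left_mono) auto
  then have "4 * q * (a1 * v0 + a2 * v2) \<le> 4 * q * (a1 * C + a2 * C)"
    using q by (intro mult_left_mono) auto
  also have "\<dots> = 4 * (C * (q * (a1 + a2)))" by (simp add: algebra_simps)
  also have "\<dots> \<le> 16 * C * (q * (a1 + a2))" using q a by (intro weaken nn) auto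
  finally show "a0 * v0 \<le> 16 * C * (a0 * a1 * (a1 + a2) / (b0 * b1))"
    using s2 by (simp add: q' algebra_simps)
  have "x * v1 + y * v3 \<le> x * C + y * C"
    using x y C by (intro add_mono mult_left_mono) auto
  then have "8 * q * (x * v1 + y * v3) \<le> 8 * q * (x * C + y * C)"
    using q by (intro mult_left_mono) auto
  also have "\<dots> = 8 * (C * (q * (x + y)))" by (simp add: algebra_simps)
  also have "\<dots> \<le> 16 * C * (q * (x + y))" using q x y by (intro weaken nn) auto
  also have "x + y = a1\<^sup>2 / b0 + a2 * (a2 + a3) / b2"
    by (simp add: x_def y_def power2_eq_square add_divide_distrib algebra_simps)
  finally show "a0 * v0 \<le> 16 * C * (a0 * a1 / (b0 * b1) * (a1\<^sup>2 / b0 + a2 * (a2 + a3) / b2))"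
    using s3 by (simp add: q')
  have "x * v1 + y * v3 \<le> x * (2 * ((a1 + a2) / b1 * C)) + y * (2 * ((a3 + a4) / b3 * C))"
    using x y v1 v3 by (intro add_mono mult_left_mono) auto
  then have "8 * q * (x * v1 + y * v3)
      \<le> 8 * q * (x * (2 * ((a1 + a2) / b1 * C)) + y * (2 * ((a3 + a4) / b3 * C)))"
    using q by (intro mult_left_mono) auto
  also have "8 * q * (x * (2 * (r * C)) + y * (2 * (s * C))) = 16 * C * (q * (x * r + y * s))" for r s
    by (simp add: algebra_simps)
  also have "y * ((a3 + a4) / b3) = a2 * a3 * (a3 + a4) / (b2 * b3)"
    by (simp add: y_def)
  finally show "a0 * v0 \<le> 16 * C * (a0 * a1 / (b0 * b1) *
      ((a1\<^sup>2 / b0 + a2\<^sup>2 / b2) * ((a1 + a2) / b1) + a2 * a3 * (a3 + a4) / (b2 * b3)))"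
    using s3 by (simp add: q' x_def)
qed

text \<open>Once the last four diagonal entries are large, each of the last four rows can be solved
  for its middle entry, and the boundary term is at most \<open>16 * C\<close> times the expression
  that tends to 0. The threshold for \<open>N\<close> is uniform in \<open>u\<close> and
  \<open>z\<close>, since later both depend on \<open>N\<close>.\<close>

lemma boundary_decay:
  fixes a b :: "nat \<Rightarrow> real"
  assumes pos: "\<And>n. n \<ge> 1 \<Longrightarrow> a n > 0"
    and b: "filterlim (\<lambda>n. \<bar>b n\<bar>) at_top sequentially"
    and cond:
      "((\<lambda>n. a n * a (n-1) / \<bar>b n\<bar>) \<longlonglongrightarrow> 0) \<or>
       ((\<lambda>n. a n * a (n-1) * (a (n-1) + a (n-2)) / (\<bar>b n\<bar> * \<bar>b (n-1)\<bar>)) \<longlonglongrightarrow> 0) \<or>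
       ((\<lambda>n. a n * a (n-1) / (\<bar>b n\<bar> * \<bar>b (n-1)\<bar>) *
              ((a (n-1))\<^sup>2 / \<bar>b n\<bar> + a (n-2) * (a (n-2) + a (n-3)) / \<bar>b (n-2)\<bar>))
          \<longlonglongrightarrow> 0) \<or>
       ((\<lambda>n. a n * a (n-1) / (\<bar>b n\<bar> * \<bar>b (n-1)\<bar>) *
              (((a (n-1))\<^sup>2 / \<bar>b n\<bar> + (a (n-2))\<^sup>2 / \<bar>b (n-2)\<bar>) *
                 ((a (n-1) + a (n-2)) / \<bar>b (n-1)\<bar>) +
               a (n-2) * a (n-3) * (a (n-3) + a (n-4)) / (\<bar>b (n-2)\<bar> * \<bar>b (n-3)\<bar>)))
          \<longlonglongrightarrow> 0)"
    and "\<epsilon> > 0"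
  shows "\<forall>\<^sub>F N in sequentially. \<forall>(u :: nat \<Rightarrow> complex) (z :: complex). cmod z \<le> L \<longrightarrow> (\<forall>n\<ge>1. cmod (u n) \<le> C) \<longrightarrow> u (N + 1) = 0 \<longrightarrow>
    (\<forall>n\<in>{N-3..N}. a n * u (n + 1) + b n * u n + a (n - 1) * u (n - 1) = z * u n) \<longrightarrow>
    a N * cmod (u N) < \<epsilon>"
proof -
  define F where "F \<equiv> \<lambda>n. [a n * a (n-1) / \<bar>b n\<bar>,
    a n * a (n-1) * (a (n-1) + a (n-2)) / (\<bar>b n\<bar> * \<bar>b (n-1)\<bar>),
    a n * a (n-1) / (\<bar>b n\<bar> * \<bar>b (n-1)\<bar>) *
      ((a (n-1))\<^sup>2 / \<bar>b n\<bar> + a (n-2) * (a (n-2) + a (n-3)) / \<bar>b (n-2)\<bar>),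
    a n * a (n-1) / (\<bar>b n\<bar> * \<bar>b (n-1)\<bar>) *
      (((a (n-1))\<^sup>2 / \<bar>b n\<bar> + (a (n-2))\<^sup>2 / \<bar>b (n-2)\<bar>) * ((a (n-1) + a (n-2)) / \<bar>b (n-1)\<bar>) +
       a (n-2) * a (n-3) * (a (n-3) + a (n-4)) / (\<bar>b (n-2)\<bar> * \<bar>b (n-3)\<bar>))]"
  obtain i where i: "i < 4" and F: "(\<lambda>n. F n ! i) \<longlonglongrightarrow> 0"
  proof -
    have "\<exists>i<4. (\<lambda>n. F n ! i) \<longlonglongrightarrow> 0"
      using cond unfolding F_def
      by (elim disjE) (rule exI[of _ 0] exI[of _ 1] exI[of _ 2] exI[of _ 3], simp; fail)+
    then show ?thesis using that by blast
  qed
  have "(\<lambda>n. 16 * C * F n ! i) \<longlonglongrightarrow> 0"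
    using tendsto_mult_left[OF F, of "16 * C"] by simp
  then have small: "\<forall>\<^sub>F N in sequentially. 16 * C * F N ! i < \<epsilon>"
    using order_tendstoD(2) \<open>\<epsilon> > 0\<close> by blast
  \<comment> \<open>This threshold yields both \<open>cmod z \<le> \<bar>b n\<bar> / 2\<close> and
    \<open>b n \<noteq> 0\<close>.\<close>
  have large: "\<forall>\<^sub>F n in sequentially. 2 * \<bar>L\<bar> + 1 \<le> \<bar>b (n - k)\<bar>" for k
    using filterlim_compose[OF b filterlim_minus_const_nat_at_top, of k]
    by (simp add: filterlim_at_top)
  show ?thesis
    using small large[of 0] large[of 1] large[of 2] large[of 3] eventually_ge_at_top[of 5]
  proof eventually_elim
    case (elim N)
    \<comment> \<open>Requiring \<open>N \<ge> 5\<close> makes the subtractions down to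
      \<open>N - 4\<close> genuine and keeps all indices at least 1.\<close>
    obtain m where N: "N = m + 4" "m \<ge> 1"
      using elim(6) that[of "N - 4"] by simp
    show ?case
    proof (intro allI impI)
      fix u :: "nat \<Rightarrow> complex" and z
      assume z: "cmod z \<le> L" and uC: "\<forall>n\<ge>1. cmod (u n) \<le> C" and u0: "u (N + 1) = 0"
        and rec: "\<forall>n\<in>{N-3..N}. a n * u (n + 1) + b n * u n + a (n - 1) * u (n - 1) = z * u n"
      have bb: "cmod z \<le> \<bar>b (m + k)\<bar> / 2" "b (m + k) \<noteq> 0" if "k \<in> {1,2,3,4}" for k
        using that elim(2-5) z N by (auto simp: numeral_eq_Suc)
      have R: "cmod (u (m + k + 1)) \<le> 2 * (a (m + k + 1) * cmod (u (m + k + 2)) + a (m + k) * cmod (u (m + k))) / \<bar>b (m + k + 1)\<bar>"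
        if "k \<in> {0,1,2,3}" for k
        using recurrence_bound[of a "m + k" u b z] rec[rule_format, of "m + k + 1"] bb[of "k + 1"]
          pos[of "m + k"] pos[of "m + k + 1"] N that by auto
      \<comment> \<open>The last row has only one neighbour because \<open>u (N + 1) = 0\<close>;
        this starts the chain of substitutions.\<close>
      have r0: "cmod (u (m+4)) \<le> 2 * (a (m+3) * cmod (u (m+3))) / \<bar>b (m+4)\<bar>"
        using R[of 3] u0 N by (simp add: eval_nat_numeral)
      have r1: "cmod (u (m+3)) \<le> 2 * (a (m+3) * cmod (u (m+4)) + a (m+2) * cmod (u (m+2))) / \<bar>b (m+3)\<bar>"
        using R[of 2] by (simp add: eval_nat_numeral)
      have r2: "cmod (u (m+2)) \<le> 2 * (a (m+2) * cmod (u (m+3)) + a (m+1) * cmod (u (m+1))) / \<bar>b (m+2)\<bar>"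
        using R[of 1] by (simp add: eval_nat_numeral)
      have r3: "cmod (u (m+1)) \<le> 2 * (a (m+1) * cmod (u (m+2)) + a m * cmod (u m)) / \<bar>b (m+1)\<bar>"
        using R[of 0] by (simp add: eval_nat_numeral)
      have b_pos: "0 < \<bar>b (m+4)\<bar>" "0 < \<bar>b (m+3)\<bar>" "0 < \<bar>b (m+2)\<bar>" "0 < \<bar>b (m+1)\<bar>"
        using bb(2)[of 4] bb(2)[of 3] bb(2)[of 2] bb(2)[of 1] by simp_all
      have a_nn: "0 \<le> a (m+4)" "0 \<le> a (m+3)" "0 \<le> a (m+2)" "0 \<le> a (m+1)" "0 \<le> a m"
        using pos N by (auto intro!: less_imp_le)
      have u_le: "cmod (u (m+4)) \<le> C" "cmod (u (m+3)) \<le> C" "cmod (u (m+2)) \<le> C"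
        "cmod (u (m+1)) \<le> C" "cmod (u m) \<le> C"
        using uC N by auto
      note bounds = boundary_bounds[OF norm_ge_zero norm_ge_zero norm_ge_zero norm_ge_zero
          norm_ge_zero u_le a_nn b_pos r0 r1 r2 r3]
      have idx: "m + 4 - 1 = m + 3" "m + 4 - 2 = m + 2" "m + 4 - 3 = m + 1" "m + 4 - 4 = m"
        by simp_all
      have nths: "[w, x, y, t] ! 0 = w" "[w, x, y, t] ! 1 = x" "[w, x, y, t] ! 2 = y"
        "[w, x, y, t] ! 3 = t" for w x y t :: real
        by (simp_all add: eval_nat_numeral)
      have "i = 0 \<or> i = 1 \<or> i = 2 \<or> i = 3" using i by linarith
      then have "a (m+4) * cmod (u (m+4)) \<le> 16 * C * (F (m+4) ! i)"
        unfolding F_def idx using bounds by (elim disjE) (simp_all only: nths)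
      then show "a N * cmod (u N) < \<epsilon>" using elim(1) unfolding N(1) by linarith
    qed
  qed
qed

section \<open>Tridiagonal operators and their truncations\<close>

locale tridiagonal =
  fixes e :: "nat \<Rightarrow> 'a::complex_hilbert_space" and a b :: "nat \<Rightarrow> real"
  assumes basis: "orthonormal_basis e"
begin

definition H :: "nat \<Rightarrow> 'a set" where
  "H N = cspan (e ` {1..N})"

definition entry :: "nat \<Rightarrow> nat \<Rightarrow> real" where
  "entry m n = (if m = n then b n else if m = n + 1 then a n else if n = m + 1 then a m else 0)"

text \<open>
  The operator \<open>T\<^sub>N\<close>, extended by zero to the orthogonal complement of \<open>H N\<close> so that it is
  linear and continuous on the whole space.
\<close>

definition trunc :: "nat \<Rightarrow> 'a \<Rightarrow> 'a" where
  "trunc N x = (\<Sum>m=1..N. (\<Sum>n=1..N. entry m n * cinner x (e n)) *\<^sub>C e m)"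

lemma entry_commute: "entry m n = entry n m"
  by (auto simp: entry_def)

lemma cinner_basis: "m \<ge> 1 \<Longrightarrow> n \<ge> 1 \<Longrightarrow> cinner (e m) (e n) = (if m = n then 1 else 0)"
  using basis by (simp add: orthonormal_basis_def)

lemma norm_basis: "n \<ge> 1 \<Longrightarrow> norm (e n) = 1"
  using cinner_self[of "e n"] norm_ge_zero[of "e n"]
  by (auto simp: cinner_basis power2_eq_1_iff simp flip: of_real_power simp del: norm_ge_zero)

lemma dense_span: "closure (cspan (e ` {1..})) = UNIV"
  using basis by (simp add: orthonormal_basis_def)

lemma cinner_sum_basis:
  assumes "m \<ge> 1"
  shows "cinner (\<Sum>n=1..N. c n *\<^sub>C e n) (e m) = (if m \<le> N then c m else 0)"
proof -
  have "cinner (\<Sum>n=1..N. c n *\<^sub>C e n) (e m) = (\<Sum>n=1..N. if n = m then c n else 0)"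
    unfolding cinner.sum_left using assms
    by (intro sum.cong) (auto simp: cinner_scaleC_left cinner_basis)
  then show ?thesis using assms by auto
qed

lemma norm_cinner_basis_le: "n \<ge> 1 \<Longrightarrow> cmod (cinner x (e n)) \<le> norm x"
  using norm_cinner_le[of x "e n"] by (simp add: norm_basis)

lemma subspace_H: "complex_vector.subspace (H N)"
  by (simp add: H_def)

lemmas H_add = complex_vector.subspace_add[OF subspace_H]
  and H_diff = complex_vector.subspace_diff[OF subspace_H]
  and H_scale = complex_vector.subspace_scale[OF subspace_H]

lemma basis_in_H: "1 \<le> n \<Longrightarrow> n \<le> N \<Longrightarrow> e n \<in> H N"
  unfolding H_def by (intro complex_vector.span_base) auto

lemma sum_in_H: "(\<Sum>n=1..N. c n *\<^sub>C e n) \<in> H N"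
  by (intro complex_vector.subspace_sum[OF subspace_H] H_scale basis_in_H) auto

lemma H_mono: "M \<le> N \<Longrightarrow> H M \<subseteq> H N"
  unfolding H_def by (intro complex_vector.span_mono) auto

lemma H_expand:
  assumes "x \<in> H N"
  shows "(\<Sum>n=1..N. cinner x (e n) *\<^sub>C e n) = x"
proof -
  have "H N \<subseteq> {x. (\<Sum>n=1..N. cinner x (e n) *\<^sub>C e n) = x}"
    unfolding H_def
  proof (rule complex_vector.span_minimal)
    show "e ` {1..N} \<subseteq> {x. (\<Sum>n=1..N. cinner x (e n) *\<^sub>C e n) = x}"
    proof safe
      fix m assume m: "m \<in> {1..N}"
      have "(\<Sum>n=1..N. cinner (e m) (e n) *\<^sub>C e n) = (\<Sum>n=1..N. if m = n then e n else 0)"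
        using m by (intro sum.cong) (auto simp: cinner_basis)
      then show "(\<Sum>n=1..N. cinner (e m) (e n) *\<^sub>C e n) = e m" using m by simp
    qed
    show "complex_vector.subspace {x. (\<Sum>n=1..N. cinner x (e n) *\<^sub>C e n) = x}"
    proof -
      have "(\<Sum>n=1..N. (c * cinner x (e n)) *\<^sub>C e n) = c *\<^sub>C (\<Sum>n=1..N. cinner x (e n) *\<^sub>C e n)" for c x
        by (simp add: scaleC.sum_right scaleC_scaleC)
      then show ?thesis
        by (simp add: complex_vector.subspace_def cinner_add_left cinner_scaleC_left
            scaleC_add_left sum.distrib cinner.zero_left)
    qed
  qed
  then show ?thesis using assms by auto
qed

lemma cinner_eq_0_above: "x \<in> H N \<Longrightarrow> n > N \<Longrightarrow> cinner x (e n) = 0"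
  by (subst H_expand[symmetric], assumption, subst cinner_sum_basis) auto

text \<open>The spaces \<open>H N\<close> increase, so their union is already a subspace.\<close>

lemma span_eq_Union_H: "cspan (e ` {1..}) = (\<Union>N. H N)"
proof
  have "complex_vector.subspace (\<Union>N. H N)"
    unfolding complex_vector.subspace_def
  proof (intro conjI ballI allI)
    show "0 \<in> (\<Union>N. H N)"
      using complex_vector.subspace_0[OF subspace_H] by blast
    show "x + y \<in> (\<Union>N. H N)" if "x \<in> (\<Union>N. H N)" "y \<in> (\<Union>N. H N)" for x y
    proof -
      obtain M N where "x \<in> H M" "y \<in> H N" using \<open>x \<in> _\<close> \<open>y \<in> _\<close> by blast
      then have "x + y \<in> H (max M N)"
        using H_mono[of M "max M N"] H_mono[of N "max M N"] by (intro H_add) auto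
      then show ?thesis by blast
    qed
  qed (use H_scale in blast)
  then show "cspan (e ` {1..}) \<subseteq> (\<Union>N. H N)"
    using basis_in_H by (intro complex_vector.span_minimal) (auto intro!: exI)
  show "(\<Union>N. H N) \<subseteq> cspan (e ` {1..})"
    unfolding H_def by (intro UN_least complex_vector.span_mono) auto
qed

lemma cinner_trunc:
  "m \<ge> 1 \<Longrightarrow> cinner (trunc N x) (e m) = (if m \<le> N then \<Sum>n=1..N. entry m n * cinner x (e n) else 0)"
  unfolding trunc_def by (rule cinner_sum_basis)

lemma hermitian_trunc: "hermitian_on (H N) (trunc N)"
proof
  fix x y :: 'a and c
  show "trunc N (x + y) = trunc N x + trunc N y"
    by (simp add: trunc_def cinner_add_left distrib_left sum.distrib scaleC_add_left)
  show "trunc N (c *\<^sub>C x) = c *\<^sub>C trunc N x"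
    unfolding trunc_def scaleC.sum_right
    by (intro sum.cong refl)
      (simp add: cinner_scaleC_left scaleC_scaleC sum_distrib_left mult.left_commute)
  show "trunc N x \<in> H N"
    unfolding trunc_def by (rule sum_in_H)
  assume "x \<in> H N" "y \<in> H N"
  have "cinner (trunc N x) y = (\<Sum>m=1..N. \<Sum>n=1..N. entry m n * cinner x (e n) * cnj (cinner y (e m)))"
    by (simp add: trunc_def cinner.sum_left cinner_scaleC_left sum_distrib_right flip: cinner_commute)
  also have "\<dots> = (\<Sum>m=1..N. \<Sum>n=1..N. entry n m * cinner x (e n) * cnj (cinner y (e m)))"
    by (simp add: entry_commute)
  also have "\<dots> = (\<Sum>n=1..N. \<Sum>m=1..N. entry n m * cinner x (e n) * cnj (cinner y (e m)))"
    by (rule sum.swap)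
  also have "\<dots> = cinner x (trunc N y)"
    by (simp add: trunc_def cinner.sum_right cinner_scaleC_right sum_distrib_left mult_ac)
  finally show "cinner (trunc N x) y = cinner x (trunc N y)" .
qed (rule subspace_H)

section \<open>Finite-dimensional facts: continuity, compactness and solvability\<close>

lemma continuous_trunc: "continuous_on UNIV (trunc N)"
  unfolding trunc_def
  by (intro continuous_intros scaleC.continuous_on cinner.continuous_on)

text \<open>The vectors with all coefficients in the closed unit disc form a finite Minkowski sum of
  compact sets; the unit sphere of \<open>H N\<close> is cut out of this box by a closed
  set.\<close>

lemma compact_sphere_H: "compact (H N \<inter> sphere 0 1)"
proof -
  define B where "B N = {\<Sum>n=1..N. c n *\<^sub>C e n | c. \<forall>n. cmod (c n) \<le> 1}" for N
  have compact_line: "compact ((\<lambda>c. c *\<^sub>C e n) ` cball 0 1)" for n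
    by (intro compact_continuous_image scaleC.continuous_on continuous_intros) simp
  have "compact (B N)" for N
  proof (induction N)
    case 0
    have "B 0 = {0}" by (auto simp: B_def intro: exI[of _ "\<lambda>_. 0"])
    then show ?case by simp
  next
    case (Suc N)
    have "B (Suc N) = {x + y | x y. x \<in> B N \<and> y \<in> (\<lambda>c. c *\<^sub>C e (Suc N)) ` cball 0 1}"
    proof (intro equalityI subsetI)
      fix x assume "x \<in> {x + y | x y. x \<in> B N \<and> y \<in> (\<lambda>c. c *\<^sub>C e (Suc N)) ` cball 0 1}"
      then obtain c d where *: "x = (\<Sum>n=1..N. c n *\<^sub>C e n) + d *\<^sub>C e (Suc N)"
        "\<forall>n. cmod (c n) \<le> 1" "cmod d \<le> 1"
        by (auto simp: B_def)
      have "(\<Sum>n=1..N. c n *\<^sub>C e n) = (\<Sum>n=1..N. (c(Suc N := d)) n *\<^sub>C e n)"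
        by (intro sum.cong) auto
      with * show "x \<in> B (Suc N)"
        unfolding B_def by (intro CollectI exI[of _ "c(Suc N := d)"]) simp
    next
      fix x assume "x \<in> B (Suc N)"
      then obtain c where *: "x = (\<Sum>n=1..Suc N. c n *\<^sub>C e n)" "\<forall>n. cmod (c n) \<le> 1"
        by (auto simp: B_def)
      then have "x = (\<Sum>n=1..N. c n *\<^sub>C e n) + c (Suc N) *\<^sub>C e (Suc N)"
        by simp
      moreover have "(\<Sum>n=1..N. c n *\<^sub>C e n) \<in> B N"
        using * unfolding B_def by blast
      moreover have "c (Suc N) *\<^sub>C e (Suc N) \<in> (\<lambda>c. c *\<^sub>C e (Suc N)) ` cball 0 1"
        using * by (intro imageI) simp
      ultimately show "x \<in> {x + y | x y. x \<in> B N \<and> y \<in> (\<lambda>c. c *\<^sub>C e (Suc N)) ` cball 0 1}"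
        by blast
    qed
    then show ?case using compact_sums[OF Suc compact_line] by simp
  qed
  moreover have "H N \<inter> sphere 0 1 = B N \<inter> sphere 0 1"
  proof safe
    fix x assume x: "x \<in> H N" "x \<in> sphere 0 1"
    \<comment> \<open>The set \<open>B N\<close> bounds coefficients at every index, including 0,
      where \<open>e 0\<close> is arbitrary; hence the default 0.\<close>
    define c where "c n = (if n \<ge> 1 then cinner x (e n) else 0)" for n
    have "cmod (c n) \<le> 1" for n
      using norm_cinner_basis_le[of n x] x(2) by (simp add: c_def)
    moreover have "x = (\<Sum>n=1..N. c n *\<^sub>C e n)"
      using H_expand[OF x(1)] by (simp add: c_def)
    ultimately show "x \<in> B N"
      unfolding B_def by blast
  next
    fix x assume "x \<in> B N"
    then show "x \<in> H N"
      unfolding B_def using sum_in_H by blast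
  qed
  moreover have "closed (sphere (0::'a) 1)"
    unfolding sphere_def by (intro closed_Collect_eq continuous_intros)
  ultimately show ?thesis
    by (metis compact_Int_closed)
qed

lemma H_nontrivial: "N \<ge> 1 \<Longrightarrow> H N \<noteq> {0}"
  using basis_in_H[of 1 N] norm_basis[of 1] by force

text \<open>Dimension count: an injective map sends the basis of \<open>H N\<close> to
  \<open>N\<close> independent vectors, and an \<open>f\<close> outside their span would give
  \<open>N + 1\<close> independent vectors in \<open>H N\<close>.\<close>

lemma trunc_surj:
  assumes inj: "\<And>x. x \<in> H N \<Longrightarrow> trunc N x = z *\<^sub>C x \<Longrightarrow> x = 0" and f: "f \<in> H N"
  obtains x where "x \<in> H N" "trunc N x - z *\<^sub>C x = f"
proof -
  interpret T: hermitian_on "H N" "trunc N" by (rule hermitian_trunc)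
  interpret P: vector_space_pair
    "scaleC :: complex \<Rightarrow> 'a \<Rightarrow> 'a" "scaleC :: complex \<Rightarrow> 'a \<Rightarrow> 'a" ..
  define g where "g x = trunc N x - z *\<^sub>C x" for x
  have lin: "Vector_Spaces.linear scaleC scaleC g"
    by unfold_locales
      (auto simp: g_def T.add T.scale scaleC_add_right scaleC.diff_right scaleC_scaleC mult.commute)
  have inj_g: "inj_on g (H N)"
  proof (rule inj_onI)
    fix x y assume "x \<in> H N" "y \<in> H N" "g x = g y"
    then show "x = y"
      using inj[of "x - y"] H_diff[of x N y]
      by (simp add: g_def T.diff scaleC.diff_right algebra_simps)
  qed
  have inj_e: "inj_on e {1..N}"
    by (rule inj_onI) (metis atLeastAtMost_iff cinner_basis zero_neq_one)
  have "complex_vector.independent (e ` {1..N})"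
  proof
    assume "complex_vector.dependent (e ` {1..N})"
    then obtain c v where v: "v \<in> e ` {1..N}" "c v \<noteq> 0" and "(\<Sum>v\<in>e ` {1..N}. c v *\<^sub>C v) = 0"
      by (subst (asm) complex_vector.dependent_finite) auto
    then have "(\<Sum>n=1..N. c (e n) *\<^sub>C e n) = 0"
      unfolding sum.reindex[OF inj_e] by simp
    moreover obtain m where "m \<in> {1..N}" "v = e m" using v by auto
    ultimately show False
      using cinner_sum_basis[of m "\<lambda>n. c (e n)" N] v by (simp add: cinner.zero_left)
  qed
  then have ind: "complex_vector.independent (g ` e ` {1..N})"
    using P.linear_independent_injective_image[OF lin, folded cspan_def] inj_g by (simp add: H_def)
  have sub: "g x \<in> H N" if "x \<in> H N" for x
    using that by (auto simp: g_def intro: H_diff H_scale T.maps)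
  have "f \<in> cspan (g ` e ` {1..N})"
  proof (rule ccontr)
    assume notin: "f \<notin> cspan (g ` e ` {1..N})"
    then have "complex_vector.independent (insert f (g ` e ` {1..N}))"
      using ind complex_vector.independent_insertI by blast
    moreover have "insert f (g ` e ` {1..N}) \<subseteq> cspan (e ` {1..N})"
      unfolding H_def[symmetric] using f sub basis_in_H by auto
    ultimately have "card (insert f (g ` e ` {1..N})) \<le> card (e ` {1..N})"
      using complex_vector.independent_span_bound by blast
    moreover have "card (g ` e ` {1..N}) = card (e ` {1..N})"
      by (intro card_image inj_on_subset[OF inj_g]) (auto intro: basis_in_H)
    moreover have "f \<notin> g ` e ` {1..N}" 
      using notin by (rule contrapos_nn) (rule complex_vector.span_base)
    ultimately show False by (subst (asm) card_insert_disjoint) simp_all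
  qed
  then have "f \<in> g ` H N"
    unfolding H_def P.linear_span_image[OF lin, folded cspan_def] .
  then show ?thesis using that by (auto simp: g_def)
qed

end

section \<open>The closed operator in terms of its truncations\<close>

context tridiagonal
begin

abbreviation T :: "('a \<times> 'a) set" where
  "T \<equiv> tridiagonal_op e a b"

lemma trunc_sum: "trunc N (\<Sum>n=1..k. c n *\<^sub>C e n) = (\<Sum>n=1..k. c n *\<^sub>C trunc N (e n))"
proof -
  interpret A: hermitian_on "H N" "trunc N" by (rule hermitian_trunc)
  have "trunc N 0 = 0" using A.scale[of 0] by simp
  then show ?thesis by (induction k) (simp_all add: A.add A.scale)
qed

text \<open>The strict inequality matters: for \<open>n = N\<close> the component along
  \<open>e (N + 1)\<close> is cut off.\<close>

lemma trunc_basis: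
  assumes "1 \<le> n" "n < N"
  shows "trunc N (e n) = tridiagonal_image e a b n"
proof -
  have "(\<Sum>k=1..N. entry m k * cinner (e n) (e k)) = entry m n" for m
  proof -
    have "(\<Sum>k=1..N. entry m k * cinner (e n) (e k)) = (\<Sum>k=1..N. if n = k then complex_of_real (entry m k) else 0)"
      using assms by (intro sum.cong) (auto simp: cinner_basis)
    then show ?thesis using assms by simp
  qed
  then have "trunc N (e n) = (\<Sum>m=1..N. complex_of_real (entry m n) *\<^sub>C e m)"
    by (simp add: trunc_def)
  also have "\<dots> = (\<Sum>m=1..N. (if m = n + 1 then a n *\<^sub>R e m else 0) + (if m = n then b n *\<^sub>R e m else 0)
      + (if m = n - 1 then (if n = 1 then 0 else a m *\<^sub>R e m) else 0))"
    using assms by (intro sum.cong) (auto simp: entry_def scaleC_of_real)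
  also have "\<dots> = tridiagonal_image e a b n"
    unfolding sum.distrib tridiagonal_image_def using assms by auto
  finally show ?thesis .
qed

text \<open>Isolates the boundary term: on \<open>H N\<close> the larger truncation already acts as
  \<open>T\<close>, and its additional row has a single relevant entry, \<open>a N\<close>.\<close>

lemma trunc_Suc:
  assumes "x \<in> H N" "N \<ge> 1"
  shows "trunc (Suc N) x = trunc N x + (a N * cinner x (e N)) *\<^sub>C e (Suc N)"
proof -
  have 0: "cinner x (e (Suc N)) = 0" using cinner_eq_0_above[OF assms(1)] by simp
  have "(\<Sum>n=1..N. entry (Suc N) n * cinner x (e n)) = (\<Sum>n=1..N. if n = N then a n * cinner x (e n) else 0)"
    by (intro sum.cong) (auto simp: entry_def)
  then show ?thesis
    using assms(2) by (simp add: trunc_def 0)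
qed

text \<open>The last row \<open>m = N\<close> is included because the coordinate of \<open>x\<close>
  at \<open>N + 1\<close> is zero; \<open>2 \<le> m\<close> avoids the index 0.\<close>

lemma cinner_trunc_row:
  assumes "x \<in> H N" "2 \<le> m" "m \<le> N"
  shows "cinner (trunc N x) (e m)
    = a m * cinner x (e (m + 1)) + b m * cinner x (e m) + a (m - 1) * cinner x (e (m - 1))"
proof -
  have "cinner (trunc N x) (e m) = (\<Sum>n=1..N. entry m n * cinner x (e n))"
    using assms by (simp add: cinner_trunc)
  also have "\<dots> = (\<Sum>n=1..N. (if n = m + 1 then a m * cinner x (e n) else 0)
      + (if n = m then b m * cinner x (e n) else 0) + (if n = m - 1 then a n * cinner x (e n) else 0))"
    using assms by (intro sum.cong) (auto simp: entry_def)
  also have "\<dots> = a m * cinner x (e (m + 1)) + b m * cinner x (e m) + a (m - 1) * cinner x (e (m - 1))"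
    unfolding sum.distrib using assms cinner_eq_0_above[OF assms(1), of "m + 1"] by auto
  finally show ?thesis .
qed

text \<open>One additional dimension suffices, since the operator raises the index by at most
  one.\<close>

lemma tridiagonal_pre_eq: "tridiagonal_pre e a b = {(x, trunc (Suc k) x) | x k. x \<in> H k}"
proof -
  have *: "trunc (Suc k) (\<Sum>n=1..k. c n *\<^sub>C e n) = (\<Sum>n=1..k. c n *\<^sub>C tridiagonal_image e a b n)" for c k
    unfolding trunc_sum by (intro sum.cong) (auto simp: trunc_basis)
  show ?thesis
  proof safe
    fix x y assume "(x, y) \<in> tridiagonal_pre e a b"
    then obtain k c where "x = (\<Sum>n=1..k. c n *\<^sub>C e n)" "y = (\<Sum>n=1..k. c n *\<^sub>C tridiagonal_image e a b n)"
      by (auto simp: tridiagonal_pre_def)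
    then have "y = trunc (Suc k) x" "x \<in> H k"
      by (simp_all only: * sum_in_H)
    then show "\<exists>x' k. (x, y) = (x', trunc (Suc k) x') \<and> x' \<in> H k"
      by blast
  next
    fix x k assume "x \<in> H k"
    then have x: "(\<Sum>n=1..k. cinner x (e n) *\<^sub>C e n) = x" by (rule H_expand)
    show "(x, trunc (Suc k) x) \<in> tridiagonal_pre e a b"
      unfolding tridiagonal_pre_def using *[of k "\<lambda>n. cinner x (e n)"] unfolding x
      by (intro CollectI exI[of _ k] exI[of _ "\<lambda>n. cinner x (e n)"]) (simp only: x simp_thms)
  qed
qed

lemma pre_subset: "tridiagonal_pre e a b \<subseteq> T"
  unfolding tridiagonal_op_def by (rule closure_subset)

lemma closed_T: "closed T"
  unfolding tridiagonal_op_def by simp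

text \<open>Having all large \<open>N\<close> available lets several graph elements be handled in
  one common \<open>H N\<close>.\<close>

lemma pre_eventually_trunc:
  assumes "(x, y) \<in> tridiagonal_pre e a b"
  shows "\<exists>k. \<forall>N\<ge>k. x \<in> H N \<and> y = trunc N x"
proof -
  obtain k where k: "x \<in> H k" "y = trunc (Suc k) x"
    using assms by (auto simp: tridiagonal_pre_eq)
  have "trunc N x = y" if "N > k" for N
  proof -
    have x: "x = (\<Sum>n=1..k. cinner x (e n) *\<^sub>C e n)" by (rule H_expand[OF k(1), symmetric])
    show ?thesis unfolding k(2) using that
      by (subst (1 2) x, unfold trunc_sum, intro sum.cong) (auto simp: trunc_basis)
  qed
  then show ?thesis
    using k(1) H_mono by (intro exI[of _ "Suc k"]) (auto dest: Suc_leD)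
qed

lemma pre_I: "x \<in> H N \<Longrightarrow> (x, trunc (Suc N) x) \<in> T"
  by (rule subsetD[OF pre_subset], unfold tridiagonal_pre_eq) blast

lemma dense_Domain: "closure (Domain T) = UNIV"
proof -
  have "cspan (e ` {1..}) \<subseteq> Domain T"
    unfolding span_eq_Union_H by (intro UN_least subsetI) (rule DomainI[OF pre_I])
  from closure_mono[OF this] show ?thesis
    unfolding dense_span by (rule top.extremum_uniqueI)
qed

text \<open>On the span, two graph elements lie in a common \<open>H N\<close>, where
  \<open>trunc N\<close> is hermitian; adjoints are closed and insensitive to closure, so the
  inclusion extends.\<close>

lemma T_symmetric: "T \<subseteq> adjoint_op T"
proof -
  have "tridiagonal_pre e a b \<subseteq> adjoint_op (tridiagonal_pre e a b)"
  proof
    fix p assume p: "p \<in> tridiagonal_pre e a b"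
    obtain y z where yz: "p = (y, z)" by (cases p)
    obtain k where k: "\<forall>N\<ge>k. y \<in> H N \<and> z = trunc N y"
      using pre_eventually_trunc p yz by blast
    have "cinner w y = cinner x z" if xw: "(x, w) \<in> tridiagonal_pre e a b" for x w
    proof -
      obtain j where j: "\<forall>N\<ge>j. x \<in> H N \<and> w = trunc N x"
        using pre_eventually_trunc[OF xw] by blast
      show ?thesis
        using j[rule_format, of "max j k"] k[rule_format, of "max j k"] hermitian_on.hermitian[OF hermitian_trunc] by auto
    qed
    then show "p \<in> adjoint_op (tridiagonal_pre e a b)"
      by (auto simp: adjoint_op_def yz)
  qed
  then show ?thesis
    unfolding tridiagonal_op_def adjoint_closure
    by (intro closure_minimal closed_adjoint)
qed

text \<open>Real linearity is enough for differences of graph elements and for completeness of the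
  image under a map bounded below.\<close>

lemma T_subspace: "subspace T"
  unfolding tridiagonal_op_def
proof (rule subspace_closure)
  show "subspace (tridiagonal_pre e a b)"
    unfolding subspace_def
  proof (intro conjI ballI allI)
    show "0 \<in> tridiagonal_pre e a b"
      unfolding tridiagonal_pre_def zero_prod_def by (intro CollectI exI[of _ 0]) simp
    fix p q r assume p: "p \<in> tridiagonal_pre e a b"
    obtain x y where xy: "p = (x, y)" by (cases p)
    obtain j where j: "\<forall>N\<ge>j. x \<in> H N \<and> y = trunc N x"
      using pre_eventually_trunc p xy by blast
    {
      have "r *\<^sub>R p = (r *\<^sub>R x, trunc (Suc j) (r *\<^sub>R x)) \<and> r *\<^sub>R x \<in> H j"
        using j[rule_format, of j] j[rule_format, of "Suc j"] hermitian_on.scale[OF hermitian_trunc, of "Suc j" r x] H_scale[of x j r]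
        by (simp add: xy scaleC_of_real)
      then show "r *\<^sub>R p \<in> tridiagonal_pre e a b"
        unfolding tridiagonal_pre_eq by blast
    next
      assume q: "q \<in> tridiagonal_pre e a b"
      obtain x' y' where xy': "q = (x', y')" by (cases q)
      obtain k where k: "\<forall>N\<ge>k. x' \<in> H N \<and> y' = trunc N x'"
        using pre_eventually_trunc q xy' by blast
      define N where "N = max j k"
      have "p + q = (x + x', trunc (Suc N) (x + x')) \<and> x + x' \<in> H N"
        using j[rule_format, of N] j[rule_format, of "Suc N"] k[rule_format, of N] k[rule_format, of "Suc N"] hermitian_on.add[OF hermitian_trunc, of "Suc N" x x']
        by (simp add: xy xy' N_def H_add)
      then show "p + q \<in> tridiagonal_pre e a b"
        unfolding tridiagonal_pre_eq by blast
    }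
  qed
qed

text \<open>An element of the algebraic graph is seen exactly by every large truncation, so one of
  the infinitely many good \<open>N\<close> applies to it. The inequality is closed and passes to
  the closure.\<close>

lemma lower_bound_T:
  assumes inf: "\<exists>\<^sub>F N in sequentially. \<forall>x\<in>H N. \<delta> * norm x \<le> norm (trunc N x - z *\<^sub>C x)"
    and "(x, y) \<in> T"
  shows "\<delta> * norm x \<le> norm (y - z *\<^sub>C x)"
proof -
  have "tridiagonal_pre e a b \<subseteq> {p. \<delta> * norm (fst p) \<le> norm (snd p - z *\<^sub>C fst p)}"
  proof safe
    fix x y assume "(x, y) \<in> tridiagonal_pre e a b"
    then obtain k where k: "\<forall>N\<ge>k. x \<in> H N \<and> y = trunc N x"
      using pre_eventually_trunc by blast
    obtain N where "N \<ge> k" "\<forall>x\<in>H N. \<delta> * norm x \<le> norm (trunc N x - z *\<^sub>C x)"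
      using inf unfolding frequently_sequentially by blast
    with k show "\<delta> * norm (fst (x, y)) \<le> norm (snd (x, y) - z *\<^sub>C fst (x, y))" by auto
  qed
  moreover have "closed {p. \<delta> * norm (fst p) \<le> norm (snd p - z *\<^sub>C (fst p :: 'a))}"
    by (intro closed_Collect_le continuous_intros scaleC.continuous_on)
  ultimately have "T \<subseteq> {p. \<delta> * norm (fst p) \<le> norm (snd p - z *\<^sub>C fst p)}"
    unfolding tridiagonal_op_def by (rule closure_minimal)
  then show ?thesis using assms(2) by auto
qed

text \<open>On \<open>H N\<close> the operator acts as \<open>trunc (Suc N)\<close>, which differs
  from \<open>trunc N\<close> by a multiple of \<open>e (Suc N)\<close>, a vector orthogonal to
  \<open>H N\<close>.\<close>

lemma compression_eq:
  assumes "N \<ge> 1"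
  shows "compression (H N) T = {(x, trunc N x) | x. x \<in> H N}"
proof -
  have id: "orth_proj (H N) x = x" if "x \<in> H N" for x
    using that by (intro orth_proj_eqI[OF subspace_H]) (auto simp: cinner.zero_left)
  have proj: "orth_proj (H N) (trunc (Suc N) x) = trunc N x" if "x \<in> H N" for x
  proof (rule orth_proj_eqI[OF subspace_H])
    show "trunc N x \<in> H N" using that by (rule hermitian_on.maps[OF hermitian_trunc])
    fix z assume "z \<in> H N"
    then have "cinner (e (Suc N)) z = 0"
      using cinner_eq_0_above[of z N "Suc N"] cinner_commute[of z "e (Suc N)"] by simp
    then show "cinner (trunc (Suc N) x - trunc N x) z = 0"
      unfolding trunc_Suc[OF that assms] by (simp add: cinner_scaleC_left)
  qed
  \<comment> \<open>The closure \<open>T\<close> could a priori contain further pairs over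
    \<open>x\<close>; it is single-valued because it lies in the adjoint of a densely defined
    operator.\<close>
  have uniq: "y = trunc (Suc N) x" if "x \<in> H N" "(x, y) \<in> T" for x y
    using single_valued_subset[OF T_symmetric single_valued_adjoint[OF dense_Domain]] pre_I that
    by (auto dest: single_valuedD)
  show ?thesis
  proof safe
    fix x y assume "(x, y) \<in> compression (H N) T"
    then obtain w where w: "x \<in> H N" "y = orth_proj (H N) w" "(orth_proj (H N) x, w) \<in> T"
      by (auto simp only: compression_def mem_Collect_eq prod.inject)
    then have "w = trunc (Suc N) x"
      using uniq by (simp only: id)
    then show "\<exists>x'. (x, y) = (x', trunc N x') \<and> x' \<in> H N"
      using w(1,2) by (simp add: proj)
  next
    fix x assume x: "x \<in> H N"
    show "(x, trunc N x) \<in> compression (H N) T"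
      unfolding compression_def
    proof (intro CollectI exI conjI)
      show "(x, trunc N x) = (x, orth_proj (H N) (trunc (Suc N) x))"
        by (simp only: proj[OF x])
      show "(orth_proj (H N) x, trunc (Suc N) x) \<in> T"
        unfolding id[OF x] using x by (rule pre_I)
    qed (rule x)
  qed
qed

text \<open>Without an eigenvector, surjectivity comes from the dimension count, and the bounded
  inverse from the nearest eigenvalue for real \<open>z\<close> or from the imaginary part
  otherwise.\<close>

lemma truncation_spectrum_iff:
  assumes "N \<ge> 1"
  shows "z \<in> truncation_spectrum e T N \<longleftrightarrow> (\<exists>x\<in>H N. x \<noteq> 0 \<and> trunc N x = z *\<^sub>C x)"
proof -
  interpret A: hermitian_on "H N" "trunc N" by (rule hermitian_trunc)
  let ?G = "{(x, trunc N x) | x. x \<in> H N}"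
  let ?f = "\<lambda>(x, y). y - z *\<^sub>C x :: 'a"
  have ts: "truncation_spectrum e T N = spectrum_in (H N) ?G"
    using compression_eq[OF assms] by (simp add: truncation_spectrum_def H_def)
  show ?thesis
  proof
    assume "\<exists>x\<in>H N. x \<noteq> 0 \<and> trunc N x = z *\<^sub>C x"
    then obtain x where x: "x \<in> H N" "x \<noteq> 0" "trunc N x = z *\<^sub>C x" by blast
    have "trunc N 0 = 0" using A.scale[of 0] by simp
    then have "?f (x, trunc N x) = ?f (0, trunc N 0)" using x by simp
    moreover have "0 \<in> H N" using complex_vector.subspace_0[OF subspace_H] .
    ultimately have "\<not> inj_on ?f ?G" using x(1,2) unfolding inj_on_def by blast
    then show "z \<in> truncation_spectrum e T N"
      unfolding ts by (simp add: spectrum_in_def resolvent_set_in_def bij_betw_def)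
  next
    assume "z \<in> truncation_spectrum e T N"
    then have z: "z \<notin> resolvent_set_in (H N) ?G" by (simp add: ts spectrum_in_def)
    show "\<exists>x\<in>H N. x \<noteq> 0 \<and> trunc N x = z *\<^sub>C x"
    proof (rule ccontr)
      assume no: "\<not> (\<exists>x\<in>H N. x \<noteq> 0 \<and> trunc N x = z *\<^sub>C x)"
      obtain \<delta> where \<delta>: "\<delta> > 0" "\<And>x. x \<in> H N \<Longrightarrow> \<delta> * norm x \<le> norm (trunc N x - z *\<^sub>C x)"
      proof (cases "Im z = 0")
        case True
        then have zr: "z = complex_of_real (Re z)" by (simp add: complex_eq_iff)
        obtain \<mu> x where x: "x \<in> H N" "x \<noteq> 0" "trunc N x = complex_of_real \<mu> *\<^sub>C x"
          and le: "\<And>y. y \<in> H N \<Longrightarrow> \<bar>\<mu> - Re z\<bar> * norm y \<le> norm (trunc N y - complex_of_real (Re z) *\<^sub>C y)"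
          by (rule A.nearest_eigenvalue[OF continuous_trunc compact_sphere_H H_nontrivial[OF assms]]) (rule that)
        have "\<mu> \<noteq> Re z" using x no zr by metis
        then show ?thesis using that[of "\<bar>\<mu> - Re z\<bar>"] le zr by auto
      next
        case False
        then show ?thesis using that[of "\<bar>Im z\<bar>"] A.Im_bound by simp
      qed
      have inj: "inj_on ?f ?G"
      proof (rule inj_onI, safe)
        fix x y assume xy: "x \<in> H N" "y \<in> H N" "trunc N x - z *\<^sub>C x = trunc N y - z *\<^sub>C y"
        have "trunc N (x - y) = z *\<^sub>C (x - y)"
          using xy(3) by (simp add: A.diff scaleC.diff_right algebra_simps)
        then show "x = y" using no H_diff[OF xy(1,2)] by auto
        then show "trunc N x = trunc N y" by simp
      qed
      have "?f ` ?G = H N"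
      proof safe
        fix x assume "x \<in> H N"
        then show "trunc N x - z *\<^sub>C x \<in> H N" by (intro H_diff H_scale A.maps)
      next
        fix f assume "f \<in> H N"
        then obtain x where "x \<in> H N" "trunc N x - z *\<^sub>C x = f"
          using trunc_surj no by metis
        then show "f \<in> ?f ` ?G" by force
      qed
      moreover have "\<forall>(x, y)\<in>?G. norm x \<le> (1 / \<delta>) * norm (y - z *\<^sub>C x)"
        using \<delta> by (auto simp: field_simps)
      ultimately have "z \<in> resolvent_set_in (H N) ?G"
        unfolding resolvent_set_in_def bij_betw_def using inj
        by (intro CollectI conjI exI[of _ "1 / \<delta>"])
      then show False using z by contradiction
    qed
  qed
qed

end

section \<open>Spectrum and limit points\<close>

text \<open>The assumption \<open>decay\<close> is the conclusion of \<open>boundary_decay\<close>;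
  the growth conditions enter what follows only through it.\<close>

locale decaying_tridiagonal = tridiagonal +
  assumes a_pos: "n \<ge> 1 \<Longrightarrow> a n > 0"
    and decay: "\<epsilon> > 0 \<Longrightarrow> \<forall>\<^sub>F N in sequentially. \<forall>(u :: nat \<Rightarrow> complex) (z :: complex).
      cmod z \<le> L \<longrightarrow> (\<forall>n\<ge>1. cmod (u n) \<le> C) \<longrightarrow> u (N + 1) = 0 \<longrightarrow>
      (\<forall>n\<in>{N-3..N}. a n * u (n + 1) + b n * u n + a (n - 1) * u (n - 1) = z * u n) \<longrightarrow>
      a N * cmod (u N) < \<epsilon>"
begin

text \<open>A residual in \<open>H (N - 4)\<close> makes rows \<open>N - 3\<close> to
  \<open>N\<close> homogeneous, so \<open>decay\<close> applies to the coordinates of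
  \<open>x\<close>; the norm in the conclusion equals
  \<open>a N * cmod (cinner x (e N))\<close>.\<close>

lemma eventually_boundary_small:
  assumes "\<epsilon> > 0"
  shows "\<forall>\<^sub>F N in sequentially. \<forall>x\<in>H N. \<forall>z. cmod z \<le> L \<longrightarrow> norm x \<le> C \<longrightarrow>
    trunc N x - z *\<^sub>C x \<in> H (N - 4) \<longrightarrow> norm (trunc (Suc N) x - trunc N x) < \<epsilon>"
  using decay[OF assms, of L C] eventually_ge_at_top[of 5]
proof eventually_elim
  case (elim N)
  show ?case
  proof (intro ballI allI impI)
    fix x z assume x: "x \<in> H N" and z: "cmod z \<le> L" and C: "norm x \<le> C"
      and res: "trunc N x - z *\<^sub>C x \<in> H (N - 4)"
    define u where "u n = cinner x (e n)" for n
    have "\<forall>n\<ge>1. cmod (u n) \<le> C"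
      using norm_cinner_basis_le C unfolding u_def by (meson order_trans)
    moreover have "u (N + 1) = 0"
      using cinner_eq_0_above[OF x] by (simp add: u_def)
    moreover have "a n * u (n + 1) + b n * u n + a (n - 1) * u (n - 1) = z * u n" if "n \<in> {N-3..N}" for n
    proof -
      have n: "2 \<le> n" "n \<le> N" "N - 4 < n" using that elim(2) by auto
      have "cinner (trunc N x - z *\<^sub>C x) (e n) = 0"
        using res n(3) by (rule cinner_eq_0_above)
      then show ?thesis
        using cinner_trunc_row[OF x n(1,2)] by (simp add: u_def cinner.diff_left cinner_scaleC_left)
    qed
    ultimately have "a N * cmod (u N) < \<epsilon>"
      using elim(1) z by blast
    moreover have "norm (trunc (Suc N) x - trunc N x) = a N * cmod (u N)"
      using trunc_Suc[OF x] elim(2) a_pos[of N]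
      by (simp add: norm_scaleC norm_mult norm_basis u_def)
    ultimately show "norm (trunc (Suc N) x - trunc N x) < \<epsilon>" by simp
  qed
qed

text \<open>On the complete graph of \<open>T\<close>, the map \<open>(x, y)\<close> to
  \<open>y - z *\<^sub>C x\<close> is bounded below in the product norm, so its image is
  complete.\<close>

lemma closed_range:
  assumes "\<delta> > 0" and lower: "\<And>x y. (x, y) \<in> T \<Longrightarrow> \<delta> * norm x \<le> norm (y - z *\<^sub>C x)"
  shows "closed ((\<lambda>(x, y). y - z *\<^sub>C x) ` T)"
proof -
  define f where "f p = snd p - z *\<^sub>C fst p" for p :: "'a \<times> 'a"
  have f: "(\<lambda>(x, y). y - z *\<^sub>C x) = f" by (auto simp: f_def)
  have "bounded_linear f"
    unfolding f_def
    by (intro bounded_linear_sub bounded_linear_snd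
        bounded_linear_compose[OF scaleC.bounded_linear_right bounded_linear_fst])
  \<comment> \<open>Collects \<open>norm x \<le> norm (f p) / \<delta>\<close> and
    \<open>norm y \<le> norm (f p) + cmod z * norm x\<close> into
    \<open>norm p \<le> k * norm (f p)\<close>.\<close>
  moreover define k where "k = 1 + (1 + cmod z) / \<delta>"
  have k: "k > 0" using assms(1) by (simp add: k_def add_pos_nonneg)
  have "inverse k * norm p \<le> norm (f p)" if "p \<in> T" for p
  proof -
    obtain x y where p: "p = (x, y)" by (cases p)
    have x: "norm x \<le> norm (f p) / \<delta>"
      using lower[of x y] that assms(1) by (simp add: p f_def field_simps)
    have "norm p \<le> norm x + norm y" by (simp add: p norm_Pair_le)
    also have "norm y \<le> norm (f p) + cmod z * norm x"
      using norm_triangle_ineq[of "f p" "z *\<^sub>C x"] by (simp add: p f_def norm_scaleC)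
    finally have "norm p \<le> norm (f p) + (1 + cmod z) * norm x" by (simp add: algebra_simps)
    also have "\<dots> \<le> norm (f p) + (1 + cmod z) * (norm (f p) / \<delta>)"
      using x by (intro add_left_mono mult_left_mono) auto
    finally have "norm p \<le> k * norm (f p)" by (simp add: k_def algebra_simps)
    then show ?thesis using k by (simp add: field_simps)
  qed
  moreover have "complete T" using closed_T complete_eq_closed by blast
  ultimately have "complete (f ` T)"
    using k T_subspace by (intro complete_isometric_image[of "inverse k"]) auto
  then show ?thesis unfolding f by (rule complete_imp_closed)
qed

text \<open>Solving the truncated equation for \<open>f\<close> in some \<open>H k\<close> solves
  the full one up to the boundary term, so the range is dense; it is also closed, and the lower
  bound passes to \<open>T\<close>.\<close>

lemma resolvent_setI:
  assumes "\<delta> > 0"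
    and inf: "\<exists>\<^sub>F N in sequentially. \<forall>x\<in>H N. \<delta> * norm x \<le> norm (trunc N x - z *\<^sub>C x)"
  shows "z \<in> resolvent_set_in UNIV T"
proof -
  let ?g = "\<lambda>(x, y). y - z *\<^sub>C x :: 'a"
  have lower: "\<delta> * norm x \<le> norm (y - z *\<^sub>C x)" if "(x, y) \<in> T" for x y
    using lower_bound_T[OF inf that] .
  have "f \<in> closure (?g ` T)" if f: "f \<in> H k" for f k
    unfolding closure_approachable
  proof (intro allI impI)
    fix \<epsilon> :: real assume "\<epsilon> > 0"
    have "\<forall>\<^sub>F N in sequentially. (\<forall>x\<in>H N. \<forall>w. cmod w \<le> cmod z \<longrightarrow> norm x \<le> norm f / \<delta> \<longrightarrow>
        trunc N x - w *\<^sub>C x \<in> H (N - 4) \<longrightarrow> norm (trunc (Suc N) x - trunc N x) < \<epsilon>) \<and> k + 4 \<le> N"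
      using eventually_boundary_small[OF \<open>\<epsilon> > 0\<close>] eventually_ge_at_top by (rule eventually_conj)
    \<comment> \<open>Infinitely many \<open>N\<close> have the lower bound and all large ones the
      boundary estimate, so some \<open>N\<close> has both; \<open>k + 4 \<le> N\<close> places
      \<open>f\<close> in \<open>H (N - 4)\<close>.\<close>
    from frequently_eventually_conj[OF inf this]
    obtain N where N: "\<forall>x\<in>H N. \<delta> * norm x \<le> norm (trunc N x - z *\<^sub>C x)" "k + 4 \<le> N"
      and small: "\<And>x. x \<in> H N \<Longrightarrow> norm x \<le> norm f / \<delta> \<Longrightarrow> trunc N x - z *\<^sub>C x \<in> H (N - 4) \<Longrightarrow>
        norm (trunc (Suc N) x - trunc N x) < \<epsilon>"
      by (auto dest!: frequently_ex)
    have fN: "f \<in> H N" "f \<in> H (N - 4)"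
      using subsetD[OF H_mono f] N(2) by simp_all
    have zero: "x = 0" if "x \<in> H N" "trunc N x = z *\<^sub>C x" for x
    proof -
      have "\<delta> * norm x \<le> norm (trunc N x - z *\<^sub>C x)" using N(1) that(1) by blast
      then show ?thesis unfolding that(2) using \<open>\<delta> > 0\<close> by (simp add: mult_le_0_iff)
    qed
    obtain x where x: "x \<in> H N" "trunc N x - z *\<^sub>C x = f"
      by (rule trunc_surj[OF zero fN(1)])
    have "norm x \<le> norm f / \<delta>"
    proof -
      have "\<delta> * norm x \<le> norm (trunc N x - z *\<^sub>C x)" using N(1) x(1) by blast
      then show ?thesis unfolding x(2) using \<open>\<delta> > 0\<close> by (simp add: field_simps)
    qed
    then have "norm (trunc (Suc N) x - trunc N x) < \<epsilon>"
      using small x fN(2) by simp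
    also have "trunc (Suc N) x - trunc N x = (trunc (Suc N) x - z *\<^sub>C x) - f"
      unfolding x(2)[symmetric] by simp
    finally have "dist (?g (x, trunc (Suc N) x)) f < \<epsilon>" by (simp add: dist_norm)
    then show "\<exists>y\<in>?g ` T. dist y f < \<epsilon>"
      by (intro bexI[of _ "?g (x, trunc (Suc N) x)"] imageI pre_I[OF x(1)])
  qed
  moreover have closure_range: "closure (?g ` T) = ?g ` T"
    by (rule closure_closed[OF closed_range[OF \<open>\<delta> > 0\<close> lower]])
  ultimately have "cspan (e ` {1..}) \<subseteq> ?g ` T"
    unfolding span_eq_Union_H by (intro UN_least subsetI) simp
  from closure_mono[OF this] have surj: "?g ` T = UNIV"
    unfolding dense_span closure_range
    by (rule top.extremum_uniqueI)
  have inj: "inj_on ?g T"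
  proof (rule inj_onI)
    fix p q assume "p \<in> T" "q \<in> T" and eq: "?g p = ?g q"
    then have "p - q \<in> T" by (intro subspace_diff[OF T_subspace])
    then have d: "(fst p - fst q, snd p - snd q) \<in> T"
      by (simp add: minus_prod_def)
    have 0: "(snd p - snd q) - z *\<^sub>C (fst p - fst q) = 0"
      using eq by (simp add: split_beta scaleC.diff_right algebra_simps)
    have "fst p = fst q"
      using lower[OF d] unfolding 0 using \<open>\<delta> > 0\<close> by (simp add: mult_le_0_iff)
    moreover have "snd p = snd q" using 0 calculation by (simp add: scaleC.zero_right)
    ultimately show "p = q" by (rule prod_eqI)
  qed
  have "\<forall>(x, y)\<in>T. norm x \<le> (1 / \<delta>) * norm (y - z *\<^sub>C x)"
    using lower \<open>\<delta> > 0\<close> by (auto simp: field_simps)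
  then show ?thesis
    unfolding resolvent_set_in_def bij_betw_def using inj surj
    by (intro CollectI conjI exI[of _ "1 / \<delta>"])
qed

text \<open>The bound by the imaginary part holds for every truncation with the same
  constant.\<close>

lemma nonreal_resolvent:
  assumes "Im z \<noteq> 0"
  shows "z \<in> resolvent_set_in UNIV T"
proof (rule resolvent_setI[of "\<bar>Im z\<bar>"])
  show "\<exists>\<^sub>F N in sequentially. \<forall>x\<in>H N. \<bar>Im z\<bar> * norm x \<le> norm (trunc N x - z *\<^sub>C x)"
    by (intro eventually_frequently[OF sequentially_bot] always_eventually allI ballI
        hermitian_on.Im_bound[OF hermitian_trunc])
qed (use assms in simp)

lemma self_adjoint_T: "self_adjoint_op T"
  by (rule self_adjointI[OF T_symmetric dense_Domain nonreal_resolvent nonreal_resolvent]) simp_all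

text \<open>Let \<open>l N\<close> be an eigenvalue of the truncation nearest to \<open>r\<close>.
  If \<open>l\<close> failed to converge to \<open>r\<close>, infinitely many truncations would be
  uniformly bounded below at \<open>z\<close>, which would put \<open>z\<close> in the resolvent
  set.\<close>

lemma spectrum_subset_limit_points: "spectrum_op T \<subseteq> limit_points e T"
proof
  fix z assume "z \<in> spectrum_op T"
  then have z: "z \<notin> resolvent_set_in UNIV T" by (simp add: spectrum_in_def)
  then have "z = complex_of_real (Re z)"
    using nonreal_resolvent by (auto simp: complex_eq_iff)
  moreover define r where "r = Re z"
  ultimately have zr: "z = complex_of_real r" by simp
  have "\<exists>\<mu>::real. complex_of_real \<mu> \<in> truncation_spectrum e T N \<and>
      (\<forall>y\<in>H N. \<bar>\<mu> - r\<bar> * norm y \<le> norm (trunc N y - z *\<^sub>C y))" if N: "N \<ge> 1" for N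
  proof -
    interpret A: hermitian_on "H N" "trunc N" by (rule hermitian_trunc)
    obtain \<mu> x where "x \<in> H N" "x \<noteq> 0" "trunc N x = complex_of_real \<mu> *\<^sub>C x"
      and "\<And>y. y \<in> H N \<Longrightarrow> \<bar>\<mu> - r\<bar> * norm y \<le> norm (trunc N y - complex_of_real r *\<^sub>C y)"
      by (rule A.nearest_eigenvalue[OF continuous_trunc compact_sphere_H H_nontrivial[OF N]]) (rule that)
    then show ?thesis
      unfolding truncation_spectrum_iff[OF N] zr by blast
  qed
  then obtain l :: "nat \<Rightarrow> real" where l: "\<And>N. N \<ge> 1 \<Longrightarrow> complex_of_real (l N) \<in> truncation_spectrum e T N"
    and lower: "\<And>N y. N \<ge> 1 \<Longrightarrow> y \<in> H N \<Longrightarrow> \<bar>l N - r\<bar> * norm y \<le> norm (trunc N y - z *\<^sub>C y)"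
    by metis
  have "l \<longlonglongrightarrow> r"
  proof (rule tendstoI, rule ccontr)
    fix \<delta> :: real assume "\<delta> > 0" and "\<not> (\<forall>\<^sub>F N in sequentially. dist (l N) r < \<delta>)"
    then have "\<exists>\<^sub>F N in sequentially. \<not> dist (l N) r < \<delta>"
      by (simp add: not_eventually)
    from frequently_eventually_conj[OF this eventually_ge_at_top[of 1]]
    have "\<exists>\<^sub>F N in sequentially. \<forall>y\<in>H N. \<delta> * norm y \<le> norm (trunc N y - z *\<^sub>C y)"
    proof (rule frequently_elim1)
      fix N assume N: "1 \<le> N \<and> \<not> dist (l N) r < \<delta>"
      show "\<forall>y\<in>H N. \<delta> * norm y \<le> norm (trunc N y - z *\<^sub>C y)"
      proof
        fix y assume "y \<in> H N"
        have "\<delta> * norm y \<le> \<bar>l N - r\<bar> * norm y"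
          using N by (intro mult_right_mono) (auto simp: dist_real_def)
        also have "\<dots> \<le> norm (trunc N y - z *\<^sub>C y)" using lower N \<open>y \<in> H N\<close> by blast
        finally show "\<delta> * norm y \<le> norm (trunc N y - z *\<^sub>C y)" .
      qed
    qed
    then show False using resolvent_setI \<open>\<delta> > 0\<close> z by blast
  qed
  then have "(\<lambda>N. complex_of_real (l N)) \<longlonglongrightarrow> z"
    unfolding zr by (rule tendsto_of_real)
  \<comment> \<open>The whole sequence converges, so the identity serves as the subsequence.\<close>
  then have "((\<lambda>N. complex_of_real (l N)) \<circ> id) \<longlonglongrightarrow> z" by simp
  then show "z \<in> limit_points e T"
    unfolding limit_points_def
    by (intro CollectI exI[of _ "\<lambda>N. complex_of_real (l N)"] exI[of _ id] conjI allI impI l)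
      (simp_all add: strict_mono_def)
qed

text \<open>Unit eigenvectors of the truncations are approximate eigenvectors of \<open>T\<close>,
  which contradicts a bounded inverse.\<close>

lemma limit_points_subset_spectrum: "limit_points e T \<subseteq> spectrum_op T"
proof
  fix z assume "z \<in> limit_points e T"
  then obtain l r where l: "\<And>N. N \<ge> 1 \<Longrightarrow> l N \<in> truncation_spectrum e T N"
    and r: "strict_mono r" and lim: "(l \<circ> r) \<longlonglongrightarrow> z"
    unfolding limit_points_def by blast
  show "z \<in> spectrum_op T"
  proof (rule ccontr)
    assume "z \<notin> spectrum_op T"
    then obtain C where C: "\<And>x y. (x, y) \<in> T \<Longrightarrow> norm x \<le> C * norm (y - z *\<^sub>C x)"
      unfolding spectrum_in_def resolvent_set_in_def by blast
    \<comment> \<open>Chosen so that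
      \<open>(\<bar>C\<bar> + 1) * (2 * \<epsilon>) = 1 / 2 < 1\<close>; the sign of
      \<open>C\<close> is unknown.\<close>
    define \<epsilon> where "\<epsilon> = 1 / (4 * (\<bar>C\<bar> + 1))"
    have \<epsilon>: "\<epsilon> > 0" by (simp add: \<epsilon>_def add_nonneg_pos)
    have "filterlim r at_top sequentially" using r by (rule filterlim_subseq)
    then have ev: "\<forall>\<^sub>F j in sequentially. P (r j)" if "\<forall>\<^sub>F N in sequentially. P N" for P
      using that by (auto simp: filterlim_iff)
    have "\<forall>\<^sub>F j in sequentially. dist ((l \<circ> r) j) z < min \<epsilon> 1"
      using \<epsilon> by (intro tendstoD[OF lim]) auto
    then have "\<forall>\<^sub>F j in sequentially. False"
      using ev[OF eventually_boundary_small[OF \<epsilon>, of "cmod z + 1" 1]] ev[OF eventually_ge_at_top[of 1]]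
    proof eventually_elim
      case (elim j)
      define N where "N = r j"
      define w where "w = l N"
      have wz: "cmod (w - z) < \<epsilon>" "cmod (w - z) < 1"
        using elim(1) by (auto simp: w_def N_def dist_norm)
      \<comment> \<open>The eigenvalue \<open>w\<close> varies with \<open>N\<close>, so the
        boundary estimate is used with this uniform bound.\<close>
      have "cmod w \<le> cmod z + 1"
        using norm_triangle_ineq2[of w z] wz(2) by simp
      obtain v where v: "v \<in> H N" "v \<noteq> 0" "trunc N v = w *\<^sub>C v"
        using l[of N] elim(3) truncation_spectrum_iff[of N w] by (auto simp: w_def N_def)
      define x where "x = complex_of_real (inverse (norm v)) *\<^sub>C v"
      have x: "x \<in> H N" "norm x = 1" "trunc N x = w *\<^sub>C x"
        using v hermitian_on.scale[OF hermitian_trunc, of N "complex_of_real (inverse (norm v))" v]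
        by (auto simp: x_def H_scale norm_scaleC norm_inverse norm_divide scaleC_scaleC mult.commute)
      \<comment> \<open>For an eigenvector the residual is 0, which lies in every
        \<open>H M\<close>.\<close>
      have "trunc N x - w *\<^sub>C x \<in> H (N - 4)"
        using x(3) complex_vector.subspace_0[OF subspace_H] by simp
      then have "norm (trunc (Suc N) x - trunc N x) < \<epsilon>"
        using elim(2) x(1,2) \<open>cmod w \<le> cmod z + 1\<close> unfolding N_def[symmetric] by (simp del: One_nat_def)
      moreover have "norm ((w - z) *\<^sub>C x) < \<epsilon>"
        using wz(1) x(2) by (simp add: norm_scaleC)
      moreover have eq: "trunc (Suc N) x - z *\<^sub>C x = (trunc (Suc N) x - trunc N x) + (w - z) *\<^sub>C x"
        by (simp add: x(3) scaleC.diff_left)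
      ultimately have small: "norm (trunc (Suc N) x - z *\<^sub>C x) \<le> 2 * \<epsilon>"
        using norm_triangle_ineq[of "trunc (Suc N) x - trunc N x" "(w - z) *\<^sub>C x"]
        unfolding eq by linarith
      have "1 \<le> C * norm (trunc (Suc N) x - z *\<^sub>C x)"
        using C[OF pre_I[OF x(1)]] x(2) by simp
      also have "\<dots> \<le> (\<bar>C\<bar> + 1) * (2 * \<epsilon>)"
        using small by (intro mult_mono) auto
      also have "\<dots> = 1 / 2"
        by (simp add: \<epsilon>_def field_simps)
      finally show False by simp
    qed
    then show False by simp
  qed
qed

end

theorem theorem2p4:
  fixes e :: "nat \<Rightarrow> 'a::complex_hilbert_space"
    and a b :: "nat \<Rightarrow> real"
    and T :: "('a \<times> 'a) set"
  assumes "orthonormal_basis e"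
    and "\<And>n. n \<ge> 1 \<Longrightarrow> a n > 0"
    and "T = tridiagonal_op e a b"
    and "filterlim (\<lambda>n. \<bar>b n\<bar>) at_top sequentially"
    and
      "((\<lambda>n. a n * a (n-1) / \<bar>b n\<bar>) \<longlonglongrightarrow> 0) \<or>
       ((\<lambda>n. a n * a (n-1) * (a (n-1) + a (n-2)) / (\<bar>b n\<bar> * \<bar>b (n-1)\<bar>)) \<longlonglongrightarrow> 0) \<or>
       ((\<lambda>n. a n * a (n-1) / (\<bar>b n\<bar> * \<bar>b (n-1)\<bar>) *
              ((a (n-1))\<^sup>2 / \<bar>b n\<bar> + a (n-2) * (a (n-2) + a (n-3)) / \<bar>b (n-2)\<bar>))
          \<longlonglongrightarrow> 0) \<or>
       ((\<lambda>n. a n * a (n-1) / (\<bar>b n\<bar> * \<bar>b (n-1)\<bar>) *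
              (((a (n-1))\<^sup>2 / \<bar>b n\<bar> + (a (n-2))\<^sup>2 / \<bar>b (n-2)\<bar>) *
                 ((a (n-1) + a (n-2)) / \<bar>b (n-1)\<bar>) +
               a (n-2) * a (n-3) * (a (n-3) + a (n-4)) / (\<bar>b (n-2)\<bar> * \<bar>b (n-3)\<bar>)))
          \<longlonglongrightarrow> 0)"
  shows "self_adjoint_op T \<and> limit_points e T = spectrum_op T"
proof -
  interpret decaying_tridiagonal e a b
    by unfold_locales (rule assms(1), erule assms(2), rule boundary_decay[OF _ assms(4,5)], erule assms(2))
  show ?thesis
    unfolding assms(3)
    using self_adjoint_T equalityI[OF limit_points_subset_spectrum spectrum_subset_limit_points]
    by (rule conjI)
qed

end
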